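(* Let $\mathfrak{Q}=(Q,+,\cdot,\le)$ be any non-Archimedean ordered field. Then for every $c\in Q$ with $c>0$ there are models $\mathfrak{M}^E,\mathfrak{M}^G,\mathfrak{M}^P$ of Borisov's Axioms over $\mathfrak{Q}$ such that $$\mathrm{Triv}^{\uparrow}_{\mathfrak{Q}}<\mathbb{W}_{\mathfrak{M}^E}\subset {}_c\mathrm{Eucl}^{\uparrow}_{\mathfrak{Q}},\qquad \mathrm{Triv}^{\uparrow}_{\mathfrak{Q}}<\mathbb{W}_{\mathfrak{M}^G}< \mathrm{Gal}^{\uparrow}_{\mathfrak{Q}},\qquad \mathrm{Triv}^{\uparrow}_{\mathfrak{Q}}<\mathbb{W}_{\mathfrak{M}^P}< {}_c\mathrm{Poi}^{\uparrow}_{\mathfrak{Q}}.$$ Moreover, in each of these three cases there is a strictly descending countably infinite chain of models of Borisov's Axioms over $\mathfrak{Q}$, $$\cdots<\mathfrak{M}^E_i<\cdots<\mathfrak{M}^E_1<\mathfrak{M}^E_0,\qquad \cdots<\mathfrak{M}^G_i<\cdots<\mathfrak{M}^G_1<\mathfrak{M}^G_0,\qquad \cdots<\mathfrak{M}^P_i<\cdots<\mathfrak{M}^P_1<\mathfrak{M}^P_0,$$ such that $$\mathrm{Triv}^{\uparrow}_{\mathfrak{Q}}<\cdots<\mathbb{W}_{\mathfrak{M}^E_i}<\cdots<\mathbb{W}_{\mathfrak{M}^E_1}<\mathbb{W}_{\mathfrak{M}^E_0}\subset {}_c\mathrm{Eucl}^{\uparrow}_{\mathfrak{Q}},$$ $$\mathrm{Triv}^{\uparrow}_{\mathfrak{Q}}<\cdots<\mathbb{W}_{\mathfrak{M}^G_i}<\cdots<\mathbb{W}_{\mathfrak{M}^G_1}<\mathbb{W}_{\mathfrak{M}^G_0}<\mathrm{Gal}^{\uparrow}_{\mathfrak{Q}},$$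 $$\mathrm{Triv}^{\uparrow}_{\mathfrak{Q}}<\cdots<\mathbb{W}_{\mathfrak{M}^P_i}<\cdots<\mathbb{W}_{\mathfrak{M}^P_1}<\mathbb{W}_{\mathfrak{M}^P_0}<{}_c\mathrm{Poi}^{\uparrow}_{\mathfrak{Q}}$$ (each $\mathbb{W}$ being a group under composition that has $\mathrm{Triv}^{\uparrow}_{\mathfrak{Q}}$ as a proper subgroup).
   Context: Notation for relations: for groups (of maps $Q^4\to Q^4$ under composition) $H<G$ means $H$ is a proper subgroup of $G$; $\subset$ is proper set inclusion; for models, $\mathfrak{M}<\mathfrak{M}'$ means $\mathfrak{M}$ is a proper submodel of $\mathfrak{M}'$ (each sort of $\mathfrak M$ is a subset of the corresponding sort of $\mathfrak M'$, operations and relations are the restrictions, and the models differ). An ordered field is non-Archimedean if it has an element larger than every natural number. Models. A model is $\mathfrak{M}=\langle Ev,IM,IOb,Q,+,\cdot,\le,C,P\rangle$ with nonempty sets $Ev$ (events), $IM$ (inertial motions), $IOb$ (inertial observers), quantities $\mathfrak{Q}=(Q,+,\cdot,\le)$, and relations $C\subseteq IOb\times Ev\times Q^4$, $P\subseteq IM\times Ev$. "Over $\mathfrak{Q}$" means the quantity part is $\mathfrak{Q}$. For $k\in IOb$ let $C_k=\{(e,\vec p):C(k,e,\vec p)\}$; when all $C_k$ are bijections $Ev\to Q^4$, put $f_{kh}=C_k\circ C_h^{-1}:Q^4\to Q^4$ (worldview transformation), $\mathrm{wl}_k(i)=C_k[\{e\in Ev: P(i,e)\}]$ (worldline of $i$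 according to $k$), and $\mathbb{W}=\mathbb{W}_{\mathfrak{M}}=\{f_{kh}:k,h\in IOb\}$. For $\vec p=(p_0,p_1,p_2,p_3)\in Q^4$, $p_t=p_0$ and $\vec p_s=(p_1,p_2,p_3)$. A line is a set $\{\vec p+\lambda\vec v:\lambda\in Q\}$ with $\vec v\ne 0$; it is vertical if $\vec p_s=\vec q_s$ for all its points $\vec p,\vec q$, and of finite slope if it has points $\vec p,\vec q$ with $p_t\neq q_t$. Motion $i$ is stationary w.r.t. $k$ if $\mathrm{wl}_k(i)$ is a vertical line; $h$ is at rest w.r.t. $k$ if every $i\in IM$ stationary w.r.t. $h$ is stationary w.r.t. $k$. Borisov's Axioms are: BA1: $\mathfrak{Q}$ is an ordered field. BA2: for every $k\in IOb$, $C_k$ is a bijection $Ev\to Q^4$. BA3: for every vertical line $\ell$ and $k\in IOb$ there is $i\in IM$ with $\mathrm{wl}_k(i)=\ell$. BA4: for all $i\in IM$, $k\in IOb$, $\mathrm{wl}_k(i)$ is a line of finite slope. Axiom I: there are $k,h\in IOb$ with $h$ not at rest w.r.t. $k$. Axiom II: (a) for all $k\in IOb$ and $\varphi\in\mathrm{Triv}^{\uparrow}_{\mathfrak{Q}}$ there is $h\in IOb$ with $f_{kh}=\varphi$; (b) for all $k,h\in IOb$, if $h$ is at rest w.r.t. $k$ then $f_{kh}\in\mathrm{Triv}^{\uparrow}_{\mathfrak{Q}}$. Axiom III: for all $i\in IM$, $k\in IOb$, $\varphi\in\mathrm{Triv}^{\uparrow}_{\mathfrak{Q}}$ there is $i'\in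 IM$ with $\mathrm{wl}_k(i')=\varphi[\mathrm{wl}_k(i)]$. Axiom IV: for all $k,k',h\in IOb$ there is $h'\in IOb$ with $f_{hh'}=f_{kk'}$. Transformations. Let $\vec u\cdot\vec v$ be the usual scalar product, and for $c>0$ let $\vec p\odot_c\vec q=c^2p_tq_t+\vec p_s\cdot\vec q_s$ and $\vec p\diamond_c\vec q=c^2p_tq_t-\vec p_s\cdot\vec q_s$. A $c$-Euclidean isometry (resp. $c$-Poincaré transformation) is a composition of a translation and a linear map $Q^4\to Q^4$ preserving $\odot_c$ (resp. $\diamond_c$). A Galilean transformation is a composition of a translation and a linear map $T:Q^4\to Q^4$ with $|(T\vec p)_t|=|p_t|$ for all $\vec p$ and $T\vec p\cdot T\vec q=\vec p\cdot\vec q$ whenever $p_t=q_t=0$. A trivial transformation is a composition of a translation and a linear map preserving the usual scalar product on $Q^4$, which takes vertical lines to vertical lines. $T:Q^4\to Q^4$ is orthochronous if $T(1,0,0,0)_t>T(0,0,0,0)_t$. ${}_c\mathrm{Eucl}^{\uparrow}_{\mathfrak{Q}}$, $\mathrm{Gal}^{\uparrow}_{\mathfrak{Q}}$, ${}_c\mathrm{Poi}^{\uparrow}_{\mathfrak{Q}}$, $\mathrm{Triv}^{\uparrow}_{\mathfrak{Q}}$ are the sets of orthochronous $c$-Euclidean isometries, Galilean, $c$-Poincaré and trivial transformations. (${}_c\mathrm{Eucl}^{\uparrow}_{\mathfrak{Q}}$ is not a group, the others are.) *)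

theory Defs
  imports "HOL-Analysis.Cartesian_Space" "HOL-Algebra.Group"
begin

text \<open>
  The ordered field of quantities is a type of class \<^class>\<open>linordered_field\<close>; every model below
  is a model over this field, so Borisov's axiom BA1 is the class constraint on \<open>'q\<close>.
  In the index type \<open>4\<close> we have \<open>0 = 4\<close>, so the coordinates of a point of \<open>'q ^ 4\<close> are
  indexed by \<open>0, 1, 2, 3\<close>, with \<open>0\<close> the time coordinate.
\<close>

type_synonym 'q point = "'q ^ 4"

definition timec :: "'q point \<Rightarrow> 'q" where
  "timec p = p $ 0"

definition spacec :: "('q::zero) point \<Rightarrow> 'q ^ 3" where
  "spacec p = vector [p $ 1, p $ 2, p $ 3]"

definition sprod :: "('q::comm_ring_1) ^ 'n \<Rightarrow> 'q ^ 'n \<Rightarrow> 'q" where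
  "sprod u v = (\<Sum>i\<in>UNIV. u $ i * v $ i)"

definition eucl_prod :: "'q::comm_ring_1 \<Rightarrow> 'q point \<Rightarrow> 'q point \<Rightarrow> 'q" where
  "eucl_prod c p q = c\<^sup>2 * timec p * timec q + sprod (spacec p) (spacec q)"

definition mink_prod :: "'q::comm_ring_1 \<Rightarrow> 'q point \<Rightarrow> 'q point \<Rightarrow> 'q" where
  "mink_prod c p q = c\<^sup>2 * timec p * timec q - sprod (spacec p) (spacec q)"

definition is_line :: "('q::linordered_field) point set \<Rightarrow> bool" where
  "is_line l \<longleftrightarrow> (\<exists>p v. v \<noteq> 0 \<and> l = {p + a *s v | a. True})"

definition vertical_line :: "('q::linordered_field) point set \<Rightarrow> bool" where
  "vertical_line l \<longleftrightarrow> is_line l \<and> (\<forall>p\<in>l. \<forall>q\<in>l. spacec p = spacec q)"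

definition finite_slope_line :: "('q::linordered_field) point set \<Rightarrow> bool" where
  "finite_slope_line l \<longleftrightarrow> is_line l \<and> (\<exists>p\<in>l. \<exists>q\<in>l. timec p \<noteq> timec q)"

definition linear_map :: "(('q::linordered_field) point \<Rightarrow> 'q point) \<Rightarrow> bool" where
  "linear_map L \<longleftrightarrow> Vector_Spaces.linear (*s) (*s) L"

definition preserves ::
  "('q point \<Rightarrow> 'q point \<Rightarrow> 'q) \<Rightarrow> ('q point \<Rightarrow> 'q point) \<Rightarrow> bool" where
  "preserves B L \<longleftrightarrow> (\<forall>p q. B (L p) (L q) = B p q)"

definition translation_by :: "('q::linordered_field) point \<Rightarrow> 'q point \<Rightarrow> 'q point" where
  "translation_by a p = p + a"

definition orthochronous :: "(('q::linordered_field) point \<Rightarrow> 'q point) \<Rightarrow> bool" where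
  "orthochronous f \<longleftrightarrow> timec (f (axis 0 1)) > timec (f 0)"

definition euclidean_isometry ::
  "'q::linordered_field \<Rightarrow> ('q point \<Rightarrow> 'q point) \<Rightarrow> bool" where
  "euclidean_isometry c f \<longleftrightarrow>
    (\<exists>a L. linear_map L \<and> preserves (eucl_prod c) L \<and> f = translation_by a \<circ> L)"

definition poincare_transformation ::
  "'q::linordered_field \<Rightarrow> ('q point \<Rightarrow> 'q point) \<Rightarrow> bool" where
  "poincare_transformation c f \<longleftrightarrow>
    (\<exists>a L. linear_map L \<and> preserves (mink_prod c) L \<and> f = translation_by a \<circ> L)"

definition galilean_transformation ::
  "(('q::linordered_field) point \<Rightarrow> 'q point) \<Rightarrow> bool" where
  "galilean_transformation f \<longleftrightarrow>
    (\<exists>a L. linear_map L \<and> (\<forall>p. \<bar>timec (L p)\<bar> = \<bar>timec p\<bar>) \<and>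
       (\<forall>p q. timec p = 0 \<and> timec q = 0 \<longrightarrow> sprod (L p) (L q) = sprod p q) \<and>
       f = translation_by a \<circ> L)"

definition trivial_transformation ::
  "(('q::linordered_field) point \<Rightarrow> 'q point) \<Rightarrow> bool" where
  "trivial_transformation f \<longleftrightarrow>
    (\<exists>a L. linear_map L \<and> preserves sprod L \<and> f = translation_by a \<circ> L) \<and>
    (\<forall>l. vertical_line l \<longrightarrow> vertical_line (f ` l))"

definition Eucl :: "'q::linordered_field \<Rightarrow> ('q point \<Rightarrow> 'q point) set" where
  "Eucl c = {f. euclidean_isometry c f \<and> orthochronous f}"

definition Poi :: "'q::linordered_field \<Rightarrow> ('q point \<Rightarrow> 'q point) set" where
  "Poi c = {f. poincare_transformation c f \<and> orthochronous f}"

definition Gal :: "(('q::linordered_field) point \<Rightarrow> 'q point) set" where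
  "Gal = {f. galilean_transformation f \<and> orthochronous f}"

definition Triv :: "(('q::linordered_field) point \<Rightarrow> 'q point) set" where
  "Triv = {f. trivial_transformation f \<and> orthochronous f}"

definition comp_monoid :: "('a \<Rightarrow> 'a) set \<Rightarrow> ('a \<Rightarrow> 'a) monoid" where
  "comp_monoid G = \<lparr>carrier = G, mult = (\<circ>), one = id\<rparr>"

definition proper_subgroup :: "('a \<Rightarrow> 'a) set \<Rightarrow> ('a \<Rightarrow> 'a) set \<Rightarrow> bool" where
  "proper_subgroup H G \<longleftrightarrow>
    group (comp_monoid G) \<and> subgroup H (comp_monoid G) \<and> H \<noteq> G"

record ('e, 'i, 'o, 'q) model =
  Ev :: "'e set"
  IM :: "'i set"
  IOb :: "'o set"
  Crel :: "('o \<times> 'e \<times> 'q point) set"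
  Prel :: "('i \<times> 'e) set"

definition is_model :: "('e, 'i, 'o, 'q) model \<Rightarrow> bool" where
  "is_model M \<longleftrightarrow> Ev M \<noteq> {} \<and> IM M \<noteq> {} \<and> IOb M \<noteq> {} \<and>
     Crel M \<subseteq> IOb M \<times> Ev M \<times> UNIV \<and> Prel M \<subseteq> IM M \<times> Ev M"

text \<open>Both models are over the whole field \<open>'q\<close>, so nothing is required of the quantity sort.\<close>

definition proper_submodel ::
  "('e, 'i, 'o, 'q) model \<Rightarrow> ('e, 'i, 'o, 'q) model \<Rightarrow> bool" where
  "proper_submodel M M' \<longleftrightarrow>
     Ev M \<subseteq> Ev M' \<and> IM M \<subseteq> IM M' \<and> IOb M \<subseteq> IOb M' \<and>
     Crel M = Crel M' \<inter> (IOb M \<times> Ev M \<times> UNIV) \<and>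
     Prel M = Prel M' \<inter> (IM M \<times> Ev M) \<and> M \<noteq> M'"

definition coord :: "('e, 'i, 'o, 'q) model \<Rightarrow> 'o \<Rightarrow> ('e \<times> 'q point) set" where
  "coord M k = {(e, p). (k, e, p) \<in> Crel M}"

text \<open>
  Here \<open>(coord M h)\<inverse> O coord M k\<close> is the composition of the relations \<open>C\<^sub>k\<close> and \<open>C\<^sub>h\<^sup>-\<^sup>1\<close>;
  under BA2 it is the graph of a function, and \<open>wvt M k h\<close> is that function.
\<close>

definition wvt ::
  "('e, 'i, 'o, 'q) model \<Rightarrow> 'o \<Rightarrow> 'o \<Rightarrow> 'q point \<Rightarrow> 'q point" where
  "wvt M k h p = (THE q. (p, q) \<in> (coord M h)\<inverse> O coord M k)"

definition wvts :: "('e, 'i, 'o, 'q) model \<Rightarrow> ('q point \<Rightarrow> 'q point) set" where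
  "wvts M = {wvt M k h | k h. k \<in> IOb M \<and> h \<in> IOb M}"

definition wl :: "('e, 'i, 'o, 'q) model \<Rightarrow> 'o \<Rightarrow> 'i \<Rightarrow> 'q point set" where
  "wl M k i = coord M k `` {e \<in> Ev M. (i, e) \<in> Prel M}"

definition stationary :: "('e, 'i, 'o, 'q::linordered_field) model \<Rightarrow> 'i \<Rightarrow> 'o \<Rightarrow> bool" where
  "stationary M i k \<longleftrightarrow> vertical_line (wl M k i)"

definition at_rest :: "('e, 'i, 'o, 'q::linordered_field) model \<Rightarrow> 'o \<Rightarrow> 'o \<Rightarrow> bool" where
  "at_rest M h k \<longleftrightarrow> (\<forall>i\<in>IM M. stationary M i h \<longrightarrow> stationary M i k)"

definition BA2 :: "('e, 'i, 'o, 'q::linordered_field) model \<Rightarrow> bool" where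
  "BA2 M \<longleftrightarrow> (\<forall>k\<in>IOb M. \<exists>g. bij_betw g (Ev M) UNIV \<and> coord M k = {(e, g e) | e. e \<in> Ev M})"

definition BA3 :: "('e, 'i, 'o, 'q::linordered_field) model \<Rightarrow> bool" where
  "BA3 M \<longleftrightarrow> (\<forall>l. \<forall>k\<in>IOb M. vertical_line l \<longrightarrow> (\<exists>i\<in>IM M. wl M k i = l))"

definition BA4 :: "('e, 'i, 'o, 'q::linordered_field) model \<Rightarrow> bool" where
  "BA4 M \<longleftrightarrow> (\<forall>i\<in>IM M. \<forall>k\<in>IOb M. finite_slope_line (wl M k i))"

definition Ax_I :: "('e, 'i, 'o, 'q::linordered_field) model \<Rightarrow> bool" where
  "Ax_I M \<longleftrightarrow> (\<exists>k\<in>IOb M. \<exists>h\<in>IOb M. \<not> at_rest M h k)"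

definition Ax_II :: "('e, 'i, 'o, 'q::linordered_field) model \<Rightarrow> bool" where
  "Ax_II M \<longleftrightarrow>
     (\<forall>k\<in>IOb M. \<forall>\<phi>\<in>Triv. \<exists>h\<in>IOb M. wvt M k h = \<phi>) \<and>
     (\<forall>k\<in>IOb M. \<forall>h\<in>IOb M. at_rest M h k \<longrightarrow> wvt M k h \<in> Triv)"

definition Ax_III :: "('e, 'i, 'o, 'q::linordered_field) model \<Rightarrow> bool" where
  "Ax_III M \<longleftrightarrow>
     (\<forall>i\<in>IM M. \<forall>k\<in>IOb M. \<forall>\<phi>\<in>Triv. \<exists>i'\<in>IM M. wl M k i' = \<phi> ` wl M k i)"

definition Ax_IV :: "('e, 'i, 'o, 'q::linordered_field) model \<Rightarrow> bool" where
  "Ax_IV M \<longleftrightarrow>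
     (\<forall>k\<in>IOb M. \<forall>k'\<in>IOb M. \<forall>h\<in>IOb M. \<exists>h'\<in>IOb M. wvt M h h' = wvt M k k')"

definition borisov_model :: "('e, 'i, 'o, 'q::linordered_field) model \<Rightarrow> bool" where
  "borisov_model M \<longleftrightarrow> is_model M \<and> BA2 M \<and> BA3 M \<and> BA4 M \<and>
     Ax_I M \<and> Ax_II M \<and> Ax_III M \<and> Ax_IV M"

text \<open>
  Types cannot be quantified existentially, so existence claims need fixed types for the three
  non-quantity sorts. The sorts of a model are arbitrary nonempty subsets of
  the types chosen here.
\<close>

type_synonym 'q std_model = "('q point, 'q point set, 'q point \<Rightarrow> 'q point, 'q) model"

definition borisov_chain ::
  "(nat \<Rightarrow> ('e, 'i, 'o, 'q::linordered_field) model) \<Rightarrow> bool" where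
  "borisov_chain M \<longleftrightarrow> (\<forall>n. borisov_model (M n) \<and> proper_submodel (M (Suc n)) (M n) \<and>
     proper_subgroup Triv (wvts (M n)) \<and> proper_subgroup (wvts (M (Suc n))) (wvts (M n)))"

end

theory Submission
  imports Defs
begin

text \<open>
  A group \<open>W\<close> of affine maps that contains the trivial transformations, has only orthochronous
  members, and in which only trivial transformations map some vertical line to a vertical line,
  is the set of worldview transformations of a Borisov model: take the members of \<open>W\<close> as
  observers and the \<open>W\<close>-images of vertical lines as inertial motions.

  Given an infinitesimal \<open>\<omega>\<close>, let \<open>W\<^sub>n\<close> consist of the Euclidean, Galilean or Poincare maps whose
  velocity is at most a finite multiple of \<open>c\<omega>\<^sup>n\<close>. For \<open>n \<ge> 1\<close> composing such maps adds
  their velocities up to a finite factor, so \<open>W\<^sub>n\<close> is a group, even in the Euclidean case: composing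
  rotations through infinitesimal angles cannot reverse time. Maps of velocity about \<open>c\<omega>\<^sup>n\<close> separate
  \<open>W\<^sub>n\<close> from \<open>W\<^bsub>n+1\<^esub>\<close>.
\<close>

section \<open>Coordinates and the spatial scalar product\<close>

abbreviation time_axis :: "'q::linordered_field point" where
  "time_axis \<equiv> axis 0 1"

abbreviation space_prod :: "'q::linordered_field point \<Rightarrow> 'q point \<Rightarrow> 'q" where
  "space_prod p q \<equiv> sprod (spacec p) (spacec q)"

lemma UNIV_4_from_0: "UNIV = {0, 1, 2, 3 :: 4}"
proof -
  have "(4 :: 4) = 0" by simp
  with UNIV_4 show ?thesis by auto
qed

lemma sum_4_from_0: "(\<Sum>i\<in>UNIV. f i) = f 0 + (f 1 + (f 2 + f (3 :: 4)))"
proof -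
  have "(\<Sum>i\<in>{0, 1, 2, 3 :: 4}. f i) = f 0 + (f 1 + (f 2 + f 3))"
    by simp
  then show ?thesis by (simp only: UNIV_4_from_0)
qed

lemma sprod_point: "sprod p q = timec p * timec q + space_prod p q" for p q :: "'q::linordered_field point"
  by (simp add: sprod_def timec_def spacec_def sum_4_from_0 sum_3 add.assoc)

lemma space_prod_coords: "space_prod p q = p $ 1 * q $ 1 + p $ 2 * q $ 2 + p $ 3 * q $ 3"
  by (simp add: sprod_def spacec_def sum_3)

lemma spacec_eq_iff: "spacec p = spacec q \<longleftrightarrow> p $ 1 = q $ 1 \<and> p $ 2 = q $ 2 \<and> p $ 3 = q $ 3"
  by (auto simp: spacec_def vec_eq_iff forall_3)

lemma point_eq_iff: "p = q \<longleftrightarrow> timec p = timec q \<and> spacec p = spacec q"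
  for p q :: "'q::linordered_field point"
proof -
  have "(\<forall>i. p $ i = q $ i) \<longleftrightarrow> (\<forall>i\<in>{0,1,2,3}. p $ i = q $ i)"
    by (metis UNIV_4_from_0 UNIV_I)
  then show ?thesis by (simp only: vec_eq_iff[of p q] timec_def spacec_eq_iff) auto
qed

lemma timec_simps [simp]:
  "timec (p + q) = timec p + timec q" "timec (p - q) = timec p - timec q"
  "timec (a *s p) = a * timec p" "timec 0 = 0" "timec time_axis = 1"
  for p q :: "'q::linordered_field point"
  by (simp_all add: timec_def)

lemma space_prod_simps [simp]:
  "space_prod (p + q) r = space_prod p r + space_prod q r"
  "space_prod r (p + q) = space_prod r p + space_prod r q"
  "space_prod (p - q) r = space_prod p r - space_prod q r"
  "space_prod r (p - q) = space_prod r p - space_prod r q"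
  "space_prod (a *s p) r = a * space_prod p r"
  "space_prod r (a *s p) = a * space_prod r p"
  for p q r :: "'q::linordered_field point"
  by (simp_all add: space_prod_coords algebra_simps axis_def)

lemma sprod_zero [simp]: "sprod 0 u = 0" "sprod u 0 = 0"
  by (simp_all add: sprod_def)

lemma spacec_simps [simp]:
  "spacec (0 :: 'q::linordered_field point) = 0" "spacec (time_axis :: 'q point) = 0"
  by (simp_all add: spacec_def vec_eq_iff forall_3 axis_def)

lemma space_prod_self_nonneg [simp]: "0 \<le> space_prod p p"
  by (simp add: space_prod_coords)

lemma space_prod_self_eq_0_iff [simp]: "space_prod p p = 0 \<longleftrightarrow> spacec p = 0"
  for p :: "'q::linordered_field point"
proof -
  have "space_prod p p = 0 \<longleftrightarrow> p $ 1 = 0 \<and> p $ 2 = 0 \<and> p $ 3 = 0"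
    by (simp add: space_prod_coords add_nonneg_eq_0_iff)
  then show ?thesis
    using spacec_eq_iff[of p 0] by (simp add: spacec_def vec_eq_iff forall_3)
qed

lemma space_prod_commute: "space_prod p q = space_prod q p"
  by (simp add: space_prod_coords mult.commute)

text \<open>Lagrange's identity: the defect is the sum of the squares of the components of the cross
  product. Lengths stay squared throughout, since the field need not contain square roots.\<close>

lemma space_prod_Cauchy_Schwarz: "(space_prod p q)\<^sup>2 \<le> space_prod p p * space_prod q q"
proof -
  have "space_prod p p * space_prod q q - (space_prod p q)\<^sup>2 =
    (p $ 1 * q $ 2 - p $ 2 * q $ 1)\<^sup>2 + (p $ 1 * q $ 3 - p $ 3 * q $ 1)\<^sup>2
      + (p $ 2 * q $ 3 - p $ 3 * q $ 2)\<^sup>2"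
    by (simp add: space_prod_coords power2_eq_square algebra_simps)
  also have "\<dots> \<ge> 0" by simp
  finally show ?thesis by simp
qed

text \<open>The parallelogram law with the term for \<open>p - q\<close> dropped. It stands in for
  the triangle inequality, which would need square roots.\<close>

lemma space_prod_add_self_le:
  "space_prod (p + q) (p + q) \<le> 2 * space_prod p p + 2 * space_prod q q"
proof -
  have "0 \<le> space_prod (p - q) (p - q)" by (rule space_prod_self_nonneg)
  then show ?thesis by (simp add: space_prod_commute[of q p])
qed

lemma eq_scaled_time_axis_iff: "p = timec p *s time_axis \<longleftrightarrow> spacec p = 0"
  by (auto simp add: point_eq_iff spacec_def vec_eq_iff forall_3 axis_def timec_def)

section \<open>Groups of affine maps\<close>

text \<open>Inverses are required as two-sided inverse maps inside the set, so every member is a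
  bijection and no ambient group has to be fixed.\<close>

definition transformation_group :: "('a \<Rightarrow> 'a) set \<Rightarrow> bool" where
  "transformation_group W \<longleftrightarrow> id \<in> W \<and> (\<forall>f\<in>W. \<forall>g\<in>W. f \<circ> g \<in> W) \<and>
     (\<forall>f\<in>W. \<exists>g\<in>W. f \<circ> g = id \<and> g \<circ> f = id)"

lemma transformation_group_inv:
  assumes "transformation_group W" "f \<in> W"
  shows "bij f" "inv_into UNIV f \<in> W"
proof -
  obtain g where g: "g \<in> W" "f \<circ> g = id" "g \<circ> f = id"
    using assms by (auto simp: transformation_group_def)
  show "bij f" using g(2,3) o_bij by blast
  show "inv_into UNIV f \<in> W" using g inv_unique_comp by metis
qed

lemma transformation_group_comp:
  "transformation_group W \<Longrightarrow> f \<in> W \<Longrightarrow> g \<in> W \<Longrightarrow> f \<circ> g \<in> W"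
  by (simp add: transformation_group_def)

lemma group_comp_monoid: "transformation_group W \<Longrightarrow> group (comp_monoid W)"
  by (rule groupI) (auto simp: comp_monoid_def transformation_group_def comp_assoc)

lemma proper_subgroupI:
  assumes "transformation_group H" "transformation_group G" "H \<subset> G"
  shows "proper_subgroup H G"
proof -
  interpret group "comp_monoid G" by (rule group_comp_monoid[OF assms(2)])
  have "subgroup H (comp_monoid G)"
  proof (rule subgroupI)
    fix f assume f: "f \<in> H"
    obtain g where g: "g \<in> H" "g \<circ> f = id"
      using assms(1) f by (auto simp: transformation_group_def)
    have "inv\<^bsub>comp_monoid G\<^esub> f = g"
      using f g assms(3) by (intro inv_equality) (auto simp: comp_monoid_def)
    then show "inv\<^bsub>comp_monoid G\<^esub> f \<in> H" using g by simp
  qed (use assms in \<open>auto simp: transformation_group_def comp_monoid_def\<close>)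
  then show ?thesis
    using assms group_comp_monoid by (auto simp: proper_subgroup_def)
qed

definition affine_maps :: "('q::linordered_field point \<Rightarrow> 'q point) set \<Rightarrow> ('q point \<Rightarrow> 'q point) set" where
  "affine_maps K = {translation_by a \<circ> L | a L. L \<in> K}"

lemma linear_map_simps:
  assumes "linear_map L"
  shows "L (p + q) = L p + L q" "L (a *s p) = a *s L p" "L 0 = 0" "L (p - q) = L p - L q"
proof -
  interpret Vector_Spaces.linear "(*s)" "(*s)" L using assms by (simp add: linear_map_def)
  show "L (p + q) = L p + L q" "L (a *s p) = a *s L p" "L 0 = 0" "L (p - q) = L p - L q"
    by (auto simp: add scale diff)
qed

lemma linear_mapI:
  assumes "\<And>p q. L (p + q) = L p + L q" "\<And>a p. L (a *s p) = a *s L p"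
  shows "linear_map L"
  unfolding linear_map_def using assms by unfold_locales simp_all

lemma linear_map_comp: "linear_map L \<Longrightarrow> linear_map L' \<Longrightarrow> linear_map (L \<circ> L')"
  by (rule linear_mapI) (simp_all add: linear_map_simps)

text \<open>In finite dimension a linear injection is surjective, and injectivity makes its inverse
  linear. This supplies the inverses whenever a set of structure-preserving maps is shown to be a
  group.\<close>

lemma linear_map_inverse:
  assumes L: "linear_map L" and ker: "\<And>p. L p = 0 \<Longrightarrow> p = 0"
  obtains L' where "linear_map L'" "L \<circ> L' = id" "L' \<circ> L = id"
proof -
  interpret Vector_Spaces.linear "(*s)" "(*s)" L using assms by (simp add: linear_map_def)
  have "inj L" using ker by (auto simp: inj_iff_eq_0)
  then have "surj L" using L vec.linear_injective_imp_surjective by (auto simp: linear_map_def)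
  let ?M = "inv_into UNIV L"
  have LM: "L (?M p) = p" for p using \<open>surj L\<close> by (rule surj_f_inv_f)
  have "linear_map ?M"
  proof (rule linear_mapI)
    fix p q a
    show "?M (p + q) = ?M p + ?M q"
      by (rule injD[OF \<open>inj L\<close>]) (simp add: LM linear_map_simps[OF L])
    show "?M (a *s p) = a *s ?M p"
      by (rule injD[OF \<open>inj L\<close>]) (simp add: LM linear_map_simps[OF L])
  qed
  then show thesis
    using \<open>inj L\<close> \<open>surj L\<close> by (intro that[of "inv_into UNIV L"]) (simp_all add: surj_iff inj_iff)
qed

lemma affine_maps_mono: "K \<subseteq> K' \<Longrightarrow> affine_maps K \<subseteq> affine_maps K'"
  by (auto simp: affine_maps_def)

lemma affine_mapsI: "L \<in> K \<Longrightarrow> L \<in> affine_maps K"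
  unfolding affine_maps_def by (auto intro!: exI[of _ 0] simp: translation_by_def fun_eq_iff)

text \<open>A linear map fixes the origin, so the translation part vanishes. This carries strict
  inclusions between sets of linear parts over to the affine groups.\<close>

lemma linear_map_in_affine_mapsD:
  assumes "L \<in> affine_maps K" "linear_map L" "\<forall>L\<in>K. linear_map L"
  shows "L \<in> K"
proof -
  obtain a L' where L': "L = translation_by a \<circ> L'" "L' \<in> K"
    using assms(1) by (auto simp: affine_maps_def)
  have "L 0 = 0" "L' 0 = 0" using L' assms linear_map_simps(3) by blast+
  then have "a = 0" using fun_cong[OF L'(1), of 0] by (simp add: translation_by_def)
  then have "L = L'" using L' by (auto simp: translation_by_def)
  then show ?thesis using L' by simp
qed

lemma affine_maps_strict_mono:
  assumes "K \<subset> K'" "\<forall>L\<in>K'. linear_map L"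
  shows "affine_maps K \<subset> affine_maps K'"
proof -
  obtain L where L: "L \<in> K'" "L \<notin> K" using assms(1) by blast
  then have "L \<in> affine_maps K'" "L \<notin> affine_maps K"
    using affine_mapsI linear_map_in_affine_mapsD[of L K] assms by auto
  then show ?thesis using affine_maps_mono[of K K'] assms(1) by blast
qed

lemma transformation_group_affine_maps:
  assumes K: "transformation_group K" and lin: "\<forall>L\<in>K. linear_map L"
  shows "transformation_group (affine_maps K)"
  unfolding transformation_group_def
proof (intro conjI ballI)
  show "id \<in> affine_maps K" using K affine_mapsI by (auto simp: transformation_group_def)
next
  fix f g assume "f \<in> affine_maps K" "g \<in> affine_maps K"
  then obtain a L b L' where *: "f = translation_by a \<circ> L" "L \<in> K" "g = translation_by b \<circ> L'" "L' \<in> K"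
    by (auto simp: affine_maps_def)
  then have "f \<circ> g = translation_by (L b + a) \<circ> (L \<circ> L')"
    using lin by (auto simp: translation_by_def fun_eq_iff linear_map_simps)
  then show "f \<circ> g \<in> affine_maps K"
    unfolding affine_maps_def using * K transformation_group_comp by blast
next
  fix f assume "f \<in> affine_maps K"
  then obtain a L where *: "f = translation_by a \<circ> L" "L \<in> K"
    by (auto simp: affine_maps_def)
  then obtain L' where L': "L' \<in> K" "L \<circ> L' = id" "L' \<circ> L = id"
    using K by (auto simp: transformation_group_def)
  then have ids: "\<And>p. L (L' p) = p" "\<And>p. L' (L p) = p" by (metis comp_apply id_apply)+
  \<comment> \<open>Solving \<open>L p + a = q\<close> for \<open>p\<close> gives
    \<open>p = L' q - L' a\<close>.\<close>
  let ?g = "translation_by (0 - L' a) \<circ> L'"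
  have "f \<circ> ?g = id \<and> ?g \<circ> f = id"
    using *(1) linear_map_simps[of L] linear_map_simps[of L'] *(2) L'(1) lin ids
    by (auto simp: translation_by_def fun_eq_iff)
  then show "\<exists>g\<in>affine_maps K. f \<circ> g = id \<and> g \<circ> f = id"
    using L' by (auto simp: affine_maps_def)
qed

lemma orthochronous_affine: "linear_map L \<Longrightarrow> orthochronous (translation_by a \<circ> L) \<longleftrightarrow> 0 < timec (L time_axis)"
  by (simp add: orthochronous_def translation_by_def linear_map_simps)

section \<open>The model of a transformation group\<close>

text \<open>When \<open>W\<close> is a group, an event is identified with its coordinates for the
  observer \<open>id\<close>. The coordinate map of an observer is then the observer itself, and
  worldview transformations are the quotients \<open>k \<circ> inv_into UNIV h\<close>. Motions are
  sets of events, with membership as incidence.\<close>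

definition group_model :: "('q::linordered_field point \<Rightarrow> 'q point) set \<Rightarrow> 'q std_model" where
  "group_model W = \<lparr>Ev = UNIV, IM = {f ` l | f l. f \<in> W \<and> vertical_line l}, IOb = W,
     Crel = {(k, e, p). k \<in> W \<and> p = k e},
     Prel = {(i, e). i \<in> {f ` l | f l. f \<in> W \<and> vertical_line l} \<and> e \<in> i}\<rparr>"

lemma group_model_sorts [simp]:
  "Ev (group_model W) = UNIV" "IOb (group_model W) = W"
  "IM (group_model W) = {f ` l | f l. f \<in> W \<and> vertical_line l}"
  by (simp_all add: group_model_def)

lemma coord_group_model: "k \<in> W \<Longrightarrow> coord (group_model W) k = {(e, k e) | e. True}"
  by (auto simp: coord_def group_model_def)

lemma wvt_group_model:
  assumes "transformation_group W" "k \<in> W" "h \<in> W"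
  shows "wvt (group_model W) k h = k \<circ> inv_into UNIV h"
proof
  fix p
  have h: "bij h" using transformation_group_inv assms by blast
  have "(p, q) \<in> (coord (group_model W) h)\<inverse> O coord (group_model W) k \<longleftrightarrow> q = k (inv_into UNIV h p)" for q
  proof -
    have "(p, q) \<in> (coord (group_model W) h)\<inverse> O coord (group_model W) k \<longleftrightarrow> (\<exists>e. h e = p \<and> q = k e)"
      unfolding coord_group_model[OF assms(2)] coord_group_model[OF assms(3)] by blast
    also have "\<dots> \<longleftrightarrow> q = k (inv_into UNIV h p)"
      using bij_inv_eq_iff[OF h] by metis
    finally show ?thesis .
  qed
  then show "wvt (group_model W) k h p = (k \<circ> inv_into UNIV h) p"
    by (simp add: wvt_def)
qed

text \<open>Quotients of group members stay in the group, and taking \<open>id\<close> as the second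
  observer recovers each member.\<close>

lemma wvts_group_model:
  assumes "transformation_group W"
  shows "wvts (group_model W) = W"
proof
  show "wvts (group_model W) \<subseteq> W"
  proof
    fix f assume "f \<in> wvts (group_model W)"
    then obtain k h where "k \<in> W" "h \<in> W" "f = wvt (group_model W) k h"
      by (auto simp: wvts_def)
    then show "f \<in> W"
      using transformation_group_comp[OF assms] transformation_group_inv(2)[OF assms]
      by (simp add: wvt_group_model[OF assms])
  qed
next
  show "W \<subseteq> wvts (group_model W)"
  proof
    fix f assume f: "f \<in> W"
    have id: "id \<in> W" using assms by (simp add: transformation_group_def)
    have "f = wvt (group_model W) f id"
      unfolding wvt_group_model[OF assms f id] by simp
    then show "f \<in> wvts (group_model W)" unfolding wvts_def group_model_sorts using f id by blast
  qed
qed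

lemma wl_group_model:
  assumes "k \<in> W" "i \<in> IM (group_model W)"
  shows "wl (group_model W) k i = k ` i"
proof -
  have "{e. (i, e) \<in> Prel (group_model W)} = i"
    using assms(2) by (auto simp: group_model_def)
  then show ?thesis using assms(1) by (auto simp: wl_def coord_group_model)
qed

text \<open>The set \<open>W\<close> enters the two relations only through the sorts, so a smaller
  set of maps merely restricts them. The models differ in their observers.\<close>

lemma proper_submodel_group_model:
  assumes "W' \<subset> W"
  shows "proper_submodel (group_model W') (group_model W)"
proof -
  have "group_model W' \<noteq> group_model W" using assms group_model_sorts(2) by (metis less_irrefl)
  moreover have "Prel (group_model W') =
      Prel (group_model W) \<inter> (IM (group_model W') \<times> Ev (group_model W'))"
    using assms unfolding group_model_def by (simp, blast)
  moreover have "Crel (group_model W') = Crel (group_model W) \<inter> (IOb (group_model W') \<times> UNIV \<times> UNIV)"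
    using assms by (auto simp: group_model_def)
  moreover have "IM (group_model W') \<subseteq> IM (group_model W)" using assms by (simp, blast)
  ultimately show ?thesis using assms by (simp add: proper_submodel_def psubset_imp_subset)
qed

section \<open>Vertical lines, trivial transformations and the axioms\<close>

lemma finite_slope_lineI:
  assumes "timec v \<noteq> 0"
  shows "finite_slope_line {p + a *s v | a. True}"
proof -
  have "v \<noteq> 0" using assms by auto
  moreover have "p + 0 *s v \<in> {p + a *s v | a. True}" "p + 1 *s v \<in> {p + a *s v | a. True}" by blast+
  moreover have "timec (p + 0 *s v) \<noteq> timec (p + 1 *s v)" using assms by simp
  ultimately show ?thesis unfolding finite_slope_line_def is_line_def by blast
qed

lemma spacec_eq_0_iff: "spacec v = 0 \<longleftrightarrow> v $ 1 = 0 \<and> v $ 2 = 0 \<and> v $ 3 = 0"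
  by (simp add: spacec_def vec_eq_iff forall_3)

lemma vertical_direction:
  assumes "vertical_line {p + b *s v | b. True}"
  shows "spacec v = 0"
proof -
  have "p + 0 *s v \<in> {p + b *s v | b. True}" "p + 1 *s v \<in> {p + b *s v | b. True}" by blast+
  with assms have "spacec (p + 0 *s v) = spacec (p + 1 *s v)" unfolding vertical_line_def by blast
  then show ?thesis
    by (simp add: spacec_eq_iff spacec_eq_0_iff)
qed

text \<open>The direction is a nonzero multiple of \<open>time_axis\<close>; rescaling it gives all
  vertical lines one normal form.\<close>

lemma vertical_line_iff:
  "vertical_line l \<longleftrightarrow> (\<exists>p. l = {p + a *s time_axis | a. True})" (is "_ \<longleftrightarrow> ?R")
proof
  assume "vertical_line l"
  then obtain p v where v: "v \<noteq> 0" "l = {p + a *s v | a. True}"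
    unfolding vertical_line_def is_line_def by blast
  have "spacec v = 0"
    using vertical_direction \<open>vertical_line l\<close> unfolding v(2) by blast
  then obtain \<tau> where \<tau>: "v = \<tau> *s time_axis" using eq_scaled_time_axis_iff by blast
  then have "\<tau> \<noteq> 0" using v(1) by auto
  then have "a *s v = (a * \<tau>) *s time_axis" "a *s time_axis = (a / \<tau>) *s v" for a
    unfolding \<tau> by simp_all
  then have "(\<exists>a. q = p + a *s v) \<longleftrightarrow> (\<exists>a. q = p + a *s time_axis)" for q
    by metis
  then have "l = {p + a *s time_axis | a. True}" unfolding v(2) by simp
  then show ?R ..
next
  assume ?R
  then obtain p where p: "l = {p + a *s time_axis | a. True}" ..
  have "time_axis \<noteq> (0 :: 'a point)" by (metis timec_simps(4,5) zero_neq_one)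
  then show "vertical_line l"
    unfolding p vertical_line_def is_line_def by (auto simp: spacec_eq_iff axis_def)
qed

text \<open>The image has direction \<open>L time_axis\<close> whatever the base point, so slope and
  rest can be read off from that one vector.\<close>

lemma affine_image_vertical_line:
  assumes "linear_map L"
  shows "(translation_by a \<circ> L) ` {p + b *s time_axis | b. True} =
    {translation_by a (L p) + b *s L time_axis | b. True}"
proof -
  have "(translation_by a \<circ> L) (p + b *s time_axis) = translation_by a (L p) + b *s L time_axis" for b
    using linear_map_simps[OF assms] by (simp add: translation_by_def)
  then show ?thesis by (simp add: full_SetCompr_eq image_image)
qed

lemma affine_maps_cases:
  assumes "f \<in> affine_maps K"
  obtains a L where "L \<in> K" "f = translation_by a \<circ> L"
  using assms by (auto simp: affine_maps_def)

definition trivial_linear :: "('q::linordered_field point \<Rightarrow> 'q point) set" where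
  "trivial_linear = {L. linear_map L \<and> preserves sprod L \<and> L time_axis = time_axis}"

text \<open>Keeping vertical lines vertical forces \<open>L time_axis\<close> to be a multiple of
  \<open>time_axis\<close>. Preservation of the scalar product makes the factor 1 or -1, and
  orthochrony selects 1.\<close>

lemma Triv_eq_affine_maps: "Triv = affine_maps (trivial_linear :: ('q::linordered_field point \<Rightarrow> 'q point) set)"
proof (intro Set.set_eqI iffI)
  fix f :: "'q point \<Rightarrow> 'q point"
  assume "f \<in> Triv"
  then obtain a L where L: "linear_map L" "preserves sprod L" "f = translation_by a \<circ> L"
      and vert: "\<And>l. vertical_line l \<Longrightarrow> vertical_line (f ` l)" and "0 < timec (L time_axis)"
    by (auto simp: Triv_def trivial_transformation_def orthochronous_affine)
  have "vertical_line {0 + b *s time_axis :: 'q point | b. True}"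
    using vertical_line_iff by blast
  from vert[OF this] have "spacec (L time_axis) = 0"
    unfolding L(3) affine_image_vertical_line[OF L(1)] by (rule vertical_direction)
  then have *: "L time_axis = timec (L time_axis) *s time_axis" by (simp only: eq_scaled_time_axis_iff)
  have "sprod (L time_axis) (L time_axis) = sprod time_axis time_axis"
    using L(2) unfolding preserves_def by blast
  then have "(timec (L time_axis))\<^sup>2 = 1"
    by (simp add: sprod_point power2_eq_square \<open>spacec (L time_axis) = 0\<close>)
  then have "timec (L time_axis) = 1" using \<open>0 < timec (L time_axis)\<close>
    by (simp add: power2_eq_1_iff)
  then have "L time_axis = time_axis" using * by simp
  then show "f \<in> affine_maps trivial_linear" using L by (auto simp: affine_maps_def trivial_linear_def)
next
  fix f :: "'q point \<Rightarrow> 'q point"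
  assume "f \<in> affine_maps trivial_linear"
  then obtain a L where L: "linear_map L" "preserves sprod L" "L time_axis = time_axis" "f = translation_by a \<circ> L"
    by (auto elim!: affine_maps_cases simp: trivial_linear_def)
  have "vertical_line (f ` l)" if "vertical_line l" for l
  proof -
    obtain p where "l = {p + b *s time_axis | b. True}" using \<open>vertical_line l\<close> vertical_line_iff by blast
    then have "f ` l = {translation_by a (L p) + b *s time_axis | b. True}"
      using affine_image_vertical_line[OF L(1), of a p] by (simp only: L(3,4))
    then show ?thesis using vertical_line_iff by blast
  qed
  then have "trivial_transformation f" using L unfolding trivial_transformation_def by blast
  moreover have "orthochronous f" using L by (simp add: orthochronous_affine)
  ultimately show "f \<in> Triv" by (simp add: Triv_def)
qed

text \<open>The axioms that assert existence of observers or motions become equations to be solved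
  in the group \<open>W\<close>. Beyond that, \<open>future\<close> yields finite slopes, strictness
  in \<open>triv\<close> yields observers in relative motion, and \<open>rest\<close> yields part
  (b) of Axiom II.\<close>

lemma borisov_model_affine_maps:
  fixes K :: "('q::linordered_field point \<Rightarrow> 'q point) set"
  assumes K: "transformation_group K" and lin: "\<forall>L\<in>K. linear_map L"
    and triv: "trivial_linear \<subset> K"
    and future: "\<And>L. L \<in> K \<Longrightarrow> 0 < timec (L time_axis)"
    and rest: "\<And>L. L \<in> K \<Longrightarrow> spacec (L time_axis) = 0 \<Longrightarrow> L \<in> trivial_linear"
  shows "borisov_model (group_model (affine_maps K))"
proof -
  define W where "W = affine_maps K"
  define M where "M = group_model W"
  have W: "transformation_group W" unfolding W_def by (rule transformation_group_affine_maps[OF K lin])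
  have id: "id \<in> W" using W by (simp add: transformation_group_def)
  note comp = transformation_group_comp[OF W] and inv = transformation_group_inv(2)[OF W]
    and bij = transformation_group_inv(1)[OF W]
  have cancel: "f \<circ> inv_into UNIV f = id" "inv_into UNIV f \<circ> f = id" if "f \<in> W" for f
    using bij[OF that] by (simp_all add: bij_is_inj bij_is_surj surj_iff[symmetric] inj_iff[symmetric])
  have Triv_W: "Triv \<subset> W" unfolding Triv_eq_affine_maps W_def
    by (rule affine_maps_strict_mono[OF triv lin])
  have wl: "wl M k i = k ` i" if "k \<in> W" "i \<in> IM M" for k i
    using that wl_group_model unfolding M_def by blast
  have IM: "IM M = {f ` l | f l. f \<in> W \<and> vertical_line l}" and IOb: "IOb M = W" and Ev: "Ev M = UNIV"
    by (simp_all add: M_def)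
  have wvt: "wvt M k h = k \<circ> inv_into UNIV h" if "k \<in> W" "h \<in> W" for k h
    unfolding M_def by (rule wvt_group_model[OF W that])
  have vert: "vertical_line {0 + b *s time_axis :: 'q point | b. True}" using vertical_line_iff by blast

  have rest': "f \<in> Triv" if f: "f \<in> W" and v: "vertical_line (f ` {0 + b *s time_axis :: 'q point | b. True})" for f
  proof -
    obtain a L where L: "L \<in> K" "f = translation_by a \<circ> L" using f unfolding W_def by (rule affine_maps_cases)
    have "spacec (L time_axis) = 0"
      using v lin L(1) unfolding L(2) by (intro vertical_direction) (simp only: affine_image_vertical_line)
    then have "L \<in> trivial_linear" using rest L by blast
    then show ?thesis unfolding Triv_eq_affine_maps affine_maps_def using L(2) by blast
  qed
  have at_rest: "k \<circ> inv_into UNIV h \<in> Triv" if "k \<in> W" "h \<in> W" "at_rest M h k" for k h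
  proof -
    let ?l = "{0 + b *s time_axis :: 'q point | b. True}"
    \<comment> \<open>The test motion is the one that \<open>h\<close> sees as the vertical line
      through the origin; for \<open>k\<close> its worldline is the image of that line under
      \<open>k \<circ> inv_into UNIV h\<close>.\<close>
    have i: "inv_into UNIV h ` ?l \<in> IM M" using IM inv[OF that(2)] vert by blast
    have "stationary M (inv_into UNIV h ` ?l) h"
      using vert unfolding stationary_def wl[OF that(2) i] image_comp cancel[OF that(2)] by simp
    then have "stationary M (inv_into UNIV h ` ?l) k" using that(3) i unfolding at_rest_def by blast
    then have "vertical_line ((k \<circ> inv_into UNIV h) ` ?l)"
      unfolding stationary_def wl[OF that(1) i] image_comp .
    then show ?thesis using rest' comp inv that by blast
  qed

  have "is_model M"
  proof -
    have "id ` {0 + b *s time_axis :: 'q point | b. True} \<in> IM M" unfolding IM using id vert by blast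
    moreover have "IOb M \<noteq> {}" using id IOb by blast
    moreover have "Prel M \<subseteq> IM M \<times> Ev M" unfolding IM Ev by (auto simp: M_def group_model_def)
    moreover have "Crel M \<subseteq> IOb M \<times> Ev M \<times> UNIV" by (auto simp: M_def group_model_def)
    ultimately show ?thesis unfolding is_model_def using Ev by blast
  qed
  moreover have "BA2 M"
    unfolding BA2_def IOb Ev using bij coord_group_model[of _ W] by (auto simp: M_def)
  moreover have "BA3 M"
    unfolding BA3_def IOb
  proof (intro allI ballI impI)
    fix l :: "'q point set" and k assume "k \<in> W" "vertical_line l"
    then have i: "inv_into UNIV k ` l \<in> IM M" using IM inv by blast
    then have "wl M k (inv_into UNIV k ` l) = l"
      unfolding wl[OF \<open>k \<in> W\<close> i] image_comp cancel[OF \<open>k \<in> W\<close>] by simp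
    with i show "\<exists>i\<in>IM M. wl M k i = l" by blast
  qed
  moreover have "BA4 M"
    unfolding BA4_def IOb
  proof (intro ballI)
    fix i k assume i: "i \<in> IM M" and k: "k \<in> W"
    then obtain f l where f: "f \<in> W" "vertical_line l" "i = f ` l" unfolding IM by blast
    then obtain p where p: "l = {p + b *s time_axis | b. True}" using vertical_line_iff by blast
    have "k \<circ> f \<in> affine_maps K" using comp[OF k f(1)] unfolding W_def .
    then obtain a L where L: "L \<in> K" "k \<circ> f = translation_by a \<circ> L" by (rule affine_maps_cases)
    have "wl M k i = {translation_by a (L p) + b *s L time_axis | b. True}"
      using affine_image_vertical_line[of L a p] lin L
      by (simp only: wl[OF k i]) (simp only: f(3) p image_comp)
    then show "finite_slope_line (wl M k i)"
      using future[OF L(1)] by (simp only:) (intro finite_slope_lineI, simp)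
  qed
  moreover have "Ax_I M"
  proof -
    obtain f where f: "f \<in> W" "f \<notin> Triv" using Triv_W by blast
    then have "\<not> at_rest M id f" using at_rest[OF f(1) id] by auto
    then show ?thesis unfolding Ax_I_def IOb using f id by blast
  qed
  moreover have "Ax_II M"
    unfolding Ax_II_def IOb
  proof (intro conjI ballI impI)
    fix k \<phi> assume k: "k \<in> W" and "\<phi> \<in> (Triv :: ('q point \<Rightarrow> 'q point) set)"
    then have \<phi>: "\<phi> \<in> W" using Triv_W by blast
    \<comment> \<open>The solution \<open>h\<close> of
      \<open>k \<circ> inv_into UNIV h = \<phi>\<close>.\<close>
    let ?h = "inv_into UNIV \<phi> \<circ> k"
    have h: "?h \<in> W" by (intro comp inv k \<phi>)
    have "wvt M k ?h = k \<circ> (inv_into UNIV k \<circ> \<phi>)"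
      using bij[OF k] bij[OF \<phi>] by (simp add: wvt[OF k h] o_inv_distrib bij_imp_bij_inv inv_inv_eq)
    then have "wvt M k ?h = \<phi>" using cancel(1)[OF k] by (simp add: comp_assoc[symmetric])
    with h show "\<exists>h\<in>W. wvt M k h = \<phi>" by blast
  qed (use at_rest wvt in simp)
  moreover have "Ax_III M"
    unfolding Ax_III_def IOb
  proof (intro ballI)
    fix i k \<phi> assume i: "i \<in> IM M" and k: "k \<in> W" and "\<phi> \<in> (Triv :: ('q point \<Rightarrow> 'q point) set)"
    then have \<phi>: "\<phi> \<in> W" using Triv_W by blast
    obtain f l where f: "f \<in> W" "vertical_line l" "i = f ` l" using i unfolding IM by blast
    \<comment> \<open>\<open>\<phi>\<close> acts on the coordinates of \<open>k\<close>; conjugating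
      by \<open>k\<close> turns it into a map of events that still lies in \<open>W\<close>.\<close>
    let ?i = "(inv_into UNIV k \<circ> \<phi> \<circ> k \<circ> f) ` l"
    have "inv_into UNIV k \<circ> \<phi> \<circ> k \<circ> f \<in> W" by (intro comp inv k \<phi> f(1))
    then have i': "?i \<in> IM M" unfolding IM using f(2) by blast
    have "wl M k ?i = ((k \<circ> inv_into UNIV k) \<circ> \<phi> \<circ> k \<circ> f) ` l"
      using wl[OF k i'] by (simp only: image_comp comp_assoc)
    also have "\<dots> = \<phi> ` wl M k i"
      using wl[OF k i] cancel(1)[OF k] f(3) by (simp only: image_comp id_comp comp_assoc)
    finally show "\<exists>i'\<in>IM M. wl M k i' = \<phi> ` wl M k i" using i' by blast
  qed
  moreover have "Ax_IV M"
    unfolding Ax_IV_def IOb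
  proof (intro ballI)
    fix k k' h assume k: "k \<in> W" and k': "k' \<in> W" and h: "h \<in> W"
    \<comment> \<open>The solution \<open>h'\<close> of
      \<open>h \<circ> inv_into UNIV h' = k \<circ> inv_into UNIV k'\<close>.\<close>
    let ?h = "k' \<circ> (inv_into UNIV k \<circ> h)"
    have h': "?h \<in> W" by (intro comp inv k k' h)
    have "inv_into UNIV ?h = inv_into UNIV h \<circ> (k \<circ> inv_into UNIV k')"
      using bij[OF k] bij[OF k'] bij[OF h]
      by (simp add: o_inv_distrib bij_imp_bij_inv inv_inv_eq bij_comp comp_assoc)
    then have "wvt M h ?h = (h \<circ> inv_into UNIV h) \<circ> (k \<circ> inv_into UNIV k')"
      by (simp add: wvt[OF h h'] comp_assoc)
    then have "wvt M h ?h = wvt M k k'" unfolding cancel(1)[OF h] wvt[OF k k'] by simp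
    with h' show "\<exists>h'\<in>W. wvt M h h' = wvt M k k'" by blast
  qed
  ultimately show ?thesis unfolding borisov_model_def M_def W_def by blast
qed

section \<open>Maps preserving a quadratic form\<close>

text \<open>The sign \<open>\<sigma>\<close> lets one argument treat Euclidean rotations
  (\<open>\<sigma> = 1\<close>) and Lorentz boosts (\<open>\<sigma> = - 1\<close>).\<close>

definition scaled_form :: "'q::linordered_field \<Rightarrow> 'q \<Rightarrow> 'q point \<Rightarrow> 'q point \<Rightarrow> 'q" where
  "scaled_form c \<sigma> p q = c\<^sup>2 * timec p * timec q + \<sigma> * space_prod p q"

lemma eucl_prod_eq: "eucl_prod c = scaled_form c 1"
  and mink_prod_eq: "mink_prod c = scaled_form c (- 1)"
  by (simp_all add: fun_eq_iff eucl_prod_def mink_prod_def scaled_form_def)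

definition form_maps :: "'q::linordered_field \<Rightarrow> 'q \<Rightarrow> ('q point \<Rightarrow> 'q point) set" where
  "form_maps c \<sigma> = {L. linear_map L \<and> preserves (scaled_form c \<sigma>) L}"

lemma sprod_eq_scaled_form: "sprod p q = scaled_form 1 1 p q" for p q :: "'q::linordered_field point"
  by (simp add: sprod_point scaled_form_def)

text \<open>Nondegeneracy excludes a kernel: a kernel vector is orthogonal to everything, so testing
  against \<open>time_axis\<close> kills its time part and testing against itself kills its space
  part. Time-reversing maps are kept, because orthochronous Euclidean maps are not closed under
  composition.\<close>

lemma transformation_group_form_maps:
  fixes c \<sigma> :: "'q::linordered_field"
  assumes "c \<noteq> 0" "\<sigma> \<noteq> 0"
  shows "transformation_group (form_maps c \<sigma>)"
  unfolding transformation_group_def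
proof (intro conjI ballI)
  show "id \<in> form_maps c \<sigma>" by (simp add: form_maps_def preserves_def linear_mapI)
next
  fix L M assume "L \<in> form_maps c \<sigma>" "M \<in> form_maps c \<sigma>"
  then show "L \<circ> M \<in> form_maps c \<sigma>" by (simp add: form_maps_def preserves_def linear_map_comp)
next
  fix L assume L: "L \<in> form_maps c \<sigma>"
  have "p = 0" if "L p = 0" for p
  proof -
    have *: "scaled_form c \<sigma> p q = 0" for q
    proof -
      have "scaled_form c \<sigma> p q = scaled_form c \<sigma> (L p) (L q)"
        using L by (simp add: form_maps_def preserves_def)
      then show ?thesis using that by (simp add: scaled_form_def)
    qed
    have "timec p = 0" using *[of time_axis] assms by (simp add: scaled_form_def)
    then show ?thesis using *[of p] assms by (simp add: scaled_form_def point_eq_iff)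
  qed
  then obtain M where M: "linear_map M" "L \<circ> M = id" "M \<circ> L = id"
    using linear_map_inverse[of L] L by (auto simp: form_maps_def)
  have "preserves (scaled_form c \<sigma>) M"
    unfolding preserves_def
  proof (intro allI)
    fix p q
    have "L (M p) = p" "L (M q) = q" using M(2) by (metis comp_apply id_apply)+
    moreover have "scaled_form c \<sigma> (L (M p)) (L (M q)) = scaled_form c \<sigma> (M p) (M q)"
      using L by (simp add: form_maps_def preserves_def)
    ultimately show "scaled_form c \<sigma> (M p) (M q) = scaled_form c \<sigma> p q" by simp
  qed
  then show "\<exists>M\<in>form_maps c \<sigma>. L \<circ> M = id \<and> M \<circ> L = id"
    using M by (auto simp: form_maps_def)
qed

lemma trivial_linear_eq: "trivial_linear = {L \<in> form_maps 1 1. L time_axis = time_axis}"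
  unfolding trivial_linear_def form_maps_def preserves_def sprod_eq_scaled_form by auto

text \<open>\<open>trivial_linear\<close> is the stabiliser of \<open>time_axis\<close> in the
  orthogonal group \<open>form_maps 1 1\<close>, hence a group; translations are adjoined
  afterwards.\<close>

lemma transformation_group_Triv: "transformation_group (Triv :: ('q::linordered_field point \<Rightarrow> 'q point) set)"
proof -
  have G: "transformation_group (form_maps 1 1 :: ('q point \<Rightarrow> 'q point) set)"
    by (rule transformation_group_form_maps) auto
  have "transformation_group (trivial_linear :: ('q point \<Rightarrow> 'q point) set)"
    unfolding transformation_group_def
  proof (intro conjI ballI)
    fix L :: "'q point \<Rightarrow> 'q point" assume L: "L \<in> trivial_linear"
    then obtain M where M: "M \<in> form_maps 1 1" "L \<circ> M = id" "M \<circ> L = id"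
      using G unfolding transformation_group_def trivial_linear_eq by blast
    then have "M (L time_axis) = time_axis" by (metis comp_apply id_apply)
    then have "M \<in> trivial_linear" using L M(1) by (simp add: trivial_linear_eq)
    then show "\<exists>M\<in>trivial_linear. L \<circ> M = id \<and> M \<circ> L = id" using M by blast
  qed (use G in \<open>auto simp: transformation_group_def trivial_linear_eq\<close>)
  then show ?thesis
    unfolding Triv_eq_affine_maps by (rule transformation_group_affine_maps) (simp add: trivial_linear_def)
qed

section \<open>Slow motions\<close>

text \<open>Allowing any finite multiplier \<open>m\<close> absorbs the constant factors lost in
  compositions. The bound on the speed is squared to avoid square roots.\<close>

definition slow_cone :: "'q::linordered_field \<Rightarrow> 'q \<Rightarrow> nat \<Rightarrow> 'q point set" where
  "slow_cone c \<omega> n =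
    {p. 0 < timec p \<and> (\<exists>m::nat. space_prod p p \<le> (of_nat m * c * \<omega> ^ n * timec p)\<^sup>2)}"

lemma slow_coneI:
  assumes "space_prod p p \<le> (of_nat m * c * \<omega> ^ n * timec p)\<^sup>2" "0 < timec p"
  shows "p \<in> slow_cone c \<omega> n"
  using assms unfolding slow_cone_def by blast

lemma power2_left_mono:
  fixes x y :: "'q::linordered_field"
  shows "0 \<le> x \<Longrightarrow> x \<le> y \<Longrightarrow> x\<^sup>2 \<le> y\<^sup>2"
  by (rule power_mono)

text \<open>What the three geometries share for building a chain. \<open>cone_image\<close> is
  restricted to positive exponents: at exponent 0 the cone admits Euclidean rotations through
  ordinary angles, and repeating one can reverse time. \<open>boost\<close> separates consecutive
  levels.\<close>

locale kinematics =
  fixes c \<omega> :: "'q::linordered_field" and K :: "('q point \<Rightarrow> 'q point) set"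
  assumes c_pos: "0 < c" and \<omega>_pos: "0 < \<omega>" and \<omega>_infinitesimal: "\<And>m::nat. of_nat m * \<omega> < 1"
    and group: "transformation_group K" and linear: "\<forall>L\<in>K. linear_map L"
    and trivial: "trivial_linear \<subseteq> K"
    and rest: "\<And>L. L \<in> K \<Longrightarrow> spacec (L time_axis) = 0 \<Longrightarrow> 0 < timec (L time_axis) \<Longrightarrow> L \<in> trivial_linear"
    and cone_image: "\<And>L n p. L \<in> K \<Longrightarrow> L time_axis \<in> slow_cone c \<omega> (Suc n) \<Longrightarrow>
      p \<in> slow_cone c \<omega> (Suc n) \<Longrightarrow> L p \<in> slow_cone c \<omega> (Suc n)"
    and cone_inverse: "\<And>L M n. L \<in> K \<Longrightarrow> M \<in> K \<Longrightarrow> L \<circ> M = id \<Longrightarrow>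
      L time_axis \<in> slow_cone c \<omega> n \<Longrightarrow> M time_axis \<in> slow_cone c \<omega> n"
    and boost: "\<And>n. \<exists>L\<in>K. L time_axis \<in> slow_cone c \<omega> n \<and> L time_axis \<notin> slow_cone c \<omega> (Suc n)"
begin

definition slow_maps :: "nat \<Rightarrow> ('q point \<Rightarrow> 'q point) set" where
  "slow_maps n = {L \<in> K. L time_axis \<in> slow_cone c \<omega> n}"

lemma slow_cone_Suc: "slow_cone c \<omega> (Suc n) \<subseteq> slow_cone c \<omega> n"
proof
  fix p assume "p \<in> slow_cone c \<omega> (Suc n)"
  then obtain m :: nat where m: "0 < timec p" "space_prod p p \<le> (of_nat m * c * \<omega> ^ Suc n * timec p)\<^sup>2"
    by (auto simp: slow_cone_def)
  have "of_nat m * c * \<omega> ^ Suc n * timec p = \<omega> * (of_nat m * c * \<omega> ^ n * timec p)" by simp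
  also have "\<dots> \<le> 1 * (of_nat m * c * \<omega> ^ n * timec p)"
    using \<omega>_infinitesimal[of 1] c_pos \<omega>_pos m(1) by (intro mult_right_mono) auto
  finally have "(of_nat m * c * \<omega> ^ Suc n * timec p)\<^sup>2 \<le> (of_nat m * c * \<omega> ^ n * timec p)\<^sup>2"
    using c_pos \<omega>_pos m(1) by (intro power2_left_mono) auto
  then show "p \<in> slow_cone c \<omega> n" using m by (auto simp: slow_cone_def intro: order_trans)
qed

lemma slow_maps_strict: "slow_maps (Suc n) \<subset> slow_maps n"
  unfolding slow_maps_def using slow_cone_Suc[of n] boost[of n] by blast

lemma time_axis_slow: "time_axis \<in> slow_cone c \<omega> n"
  by (auto simp: slow_cone_def)

lemma trivial_slow: "trivial_linear \<subset> slow_maps n"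
proof -
  have "trivial_linear \<subseteq> slow_maps n" for n
    using trivial time_axis_slow unfolding slow_maps_def by (auto simp: trivial_linear_def)
  then show ?thesis using slow_maps_strict[of n] by blast
qed

text \<open>\<open>(L \<circ> M) time_axis\<close> is \<open>L\<close> applied to the cone vector
  \<open>M time_axis\<close>; this is why \<open>cone_image\<close> speaks of all vectors of the
  cone.\<close>

lemma transformation_group_slow: "transformation_group (slow_maps (Suc n))"
  unfolding transformation_group_def
proof (intro conjI ballI)
  show "id \<in> slow_maps (Suc n)"
    using group time_axis_slow by (auto simp: slow_maps_def transformation_group_def)
next
  fix L M assume "L \<in> slow_maps (Suc n)" "M \<in> slow_maps (Suc n)"
  then show "L \<circ> M \<in> slow_maps (Suc n)"
    using transformation_group_comp[OF group] cone_image[of L n "M time_axis"] by (auto simp: slow_maps_def)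
next
  fix L assume L: "L \<in> slow_maps (Suc n)"
  then obtain M where M: "M \<in> K" "L \<circ> M = id" "M \<circ> L = id"
    using group by (auto simp: slow_maps_def transformation_group_def)
  then have "M \<in> slow_maps (Suc n)" using L cone_inverse[of L M] by (auto simp: slow_maps_def)
  then show "\<exists>M\<in>slow_maps (Suc n). L \<circ> M = id \<and> M \<circ> L = id" using M by blast
qed

lemma linear_slow: "\<forall>L\<in>slow_maps n. linear_map L"
  using linear by (auto simp: slow_maps_def)

lemma descending_chain:
  obtains \<MM> :: "nat \<Rightarrow> 'q std_model"
  where "borisov_chain \<MM>" "wvts (\<MM> 0) \<subset> affine_maps {L \<in> K. 0 < timec (L time_axis)}"
    "transformation_group (wvts (\<MM> 0))"
proof
  \<comment> \<open>Exponents start at 1, where \<open>cone_image\<close> guarantees closure under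
    composition.\<close>
  define W where "W n = affine_maps (slow_maps (Suc n))" for n
  let ?M = "\<lambda>n. group_model (W n)"
  have W: "transformation_group (W n)" for n
    unfolding W_def by (rule transformation_group_affine_maps[OF transformation_group_slow linear_slow])
  have wvts: "wvts (?M n) = W n" for n by (rule wvts_group_model[OF W])
  have Triv: "transformation_group (Triv :: ('q point \<Rightarrow> 'q point) set)"
    by (rule transformation_group_Triv)
  have model: "borisov_model (?M n)" for n
    unfolding W_def
    by (rule borisov_model_affine_maps[OF transformation_group_slow linear_slow trivial_slow])
      (auto simp: slow_maps_def slow_cone_def intro: rest)
  have W_Suc: "W (Suc n) \<subset> W n" for n
    unfolding W_def by (rule affine_maps_strict_mono[OF slow_maps_strict linear_slow])
  have Triv_W: "Triv \<subset> W n" for n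
    unfolding W_def Triv_eq_affine_maps by (rule affine_maps_strict_mono[OF trivial_slow linear_slow])
  show "borisov_chain ?M"
    unfolding borisov_chain_def wvts
    by (intro allI conjI model proper_submodel_group_model proper_subgroupI W Triv W_Suc Triv_W)
  \<comment> \<open>Level 0 already consists of orthochronous maps and strictly contains level 1,
    which makes the inclusion of level 1 in all orthochronous maps proper.\<close>
  have "slow_maps 0 \<subseteq> {L \<in> K. 0 < timec (L time_axis)}"
    by (auto simp: slow_maps_def slow_cone_def)
  then have "slow_maps (Suc 0) \<subset> {L \<in> K. 0 < timec (L time_axis)}"
    using slow_maps_strict[of 0] by blast
  then have "W 0 \<subset> affine_maps {L \<in> K. 0 < timec (L time_axis)}"
    unfolding W_def using linear by (intro affine_maps_strict_mono) auto
  then show "wvts (?M 0) \<subset> affine_maps {L \<in> K. 0 < timec (L time_axis)}" by (simp only: wvts)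
  show "transformation_group (wvts (?M 0))" unfolding wvts by (rule W)
qed

end

section \<open>Slow motions under maps preserving a quadratic form\<close>

text \<open>Applied with \<open>a\<close> and \<open>N\<close> the time component and the squared length of the image of the time axis.\<close>

lemma slow_time_component_bounds:
  fixes a c \<mu> \<sigma> N :: "'q::linordered_field"
  assumes "0 < c" "0 \<le> \<mu>" "4 * \<mu> < 1" "\<sigma> = 1 \<or> \<sigma> = - 1" "0 < a" "0 \<le> N"
    and N: "N \<le> (\<mu> * c * a)\<^sup>2" and form: "c\<^sup>2 * a * a + \<sigma> * N = c\<^sup>2"
  shows "1 \<le> 2 * a" "a \<le> 2"
proof -
  have c2: "0 < c\<^sup>2" using assms(1) by simp
  have "\<mu>\<^sup>2 \<le> (1/4)\<^sup>2" using assms(2,3) by (intro power2_left_mono) auto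
  then have "\<mu>\<^sup>2 * (c\<^sup>2 * a\<^sup>2) \<le> (1/16) * (c\<^sup>2 * a\<^sup>2)"
    by (intro mult_right_mono) (auto simp: power2_eq_square)
  then have 1: "16 * N \<le> c\<^sup>2 * a\<^sup>2" using N by (simp add: power_mult_distrib)
  have 2: "\<bar>c\<^sup>2 * a\<^sup>2 - c\<^sup>2\<bar> \<le> N" using form assms(4,6) by (auto simp: power2_eq_square abs_le_iff)
  \<comment> \<open>In fact \<open>a\<^sup>2\<close> lies between 16/17 and 16/15; the crude bounds
    1/2 and 2 for \<open>a\<close> suffice.\<close>
  have "c\<^sup>2 * 1 \<le> c\<^sup>2 * (2 * a)\<^sup>2" using 1 2 by (simp add: power_mult_distrib abs_le_iff)
  then have "1\<^sup>2 \<le> (2 * a)\<^sup>2" using c2 by (simp only: mult_le_cancel_left_pos power_one)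
  then show "1 \<le> 2 * a" by (rule power2_le_imp_le) (use assms(5) in simp)
  have "c\<^sup>2 * a\<^sup>2 \<le> c\<^sup>2 * 2\<^sup>2" using 1 2 by (simp add: power_mult_distrib abs_le_iff)
  then have "a\<^sup>2 \<le> 2\<^sup>2" using c2 by (simp only: mult_le_cancel_left_pos)
  then show "a \<le> 2" by (rule power2_le_imp_le) simp
qed

text \<open>Split \<open>p = t *s time_axis + s\<close> with \<open>s\<close> purely spatial, so
  that \<open>L p = t *s u + w\<close>. The vector \<open>u\<close> is slow with time component
  between 1/2 and 2. As \<open>w\<close> is orthogonal to \<open>u\<close>, Cauchy-Schwarz makes its
  time component small against its spatial length, which in turn is comparable to that of
  \<open>p\<close>. So \<open>L p\<close> keeps a fixed fraction of the time \<open>t\<close>, and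
  its speed grows only by a finite factor.\<close>

lemma slow_cone_image:
  fixes c \<omega> \<sigma> :: "'q::linordered_field"
  assumes "0 < c" "0 < \<omega>" and inf: "\<And>m::nat. of_nat m * \<omega> < 1" and \<sigma>: "\<sigma> = 1 \<or> \<sigma> = - 1"
    and L: "linear_map L" "preserves (scaled_form c \<sigma>) L"
    and slow: "L time_axis \<in> slow_cone c \<omega> (Suc n)" "p \<in> slow_cone c \<omega> (Suc n)"
  shows "L p \<in> slow_cone c \<omega> (Suc n)"
proof -
  define u where "u = L time_axis"
  define a where "a = timec u"
  define t where "t = timec p"
  obtain m1 :: nat where m1: "0 < a" "space_prod u u \<le> (of_nat m1 * c * \<omega> ^ Suc n * a)\<^sup>2"
    using slow by (auto simp: slow_cone_def u_def a_def)
  obtain m2 :: nat where m2: "0 < t" "space_prod p p \<le> (of_nat m2 * c * \<omega> ^ Suc n * t)\<^sup>2"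
    using slow by (auto simp: slow_cone_def t_def)
  \<comment> \<open>A common multiplier for both speed bounds.\<close>
  define m where "m = m1 + m2"
  define \<mu> where "\<mu> = of_nat m * \<omega> ^ Suc n"
  have c2: "0 < c\<^sup>2" using assms(1) by simp
  have \<omega>1: "\<omega> < 1" using inf[of 1] by simp
  have \<mu>: "0 \<le> \<mu>" "4 * \<mu> < 1"
  proof -
    show "0 \<le> \<mu>" using assms(2) by (simp add: \<mu>_def)
    \<comment> \<open>The exponent \<open>Suc n\<close> supplies one factor \<open>\<omega>\<close>,
      which is infinitesimal against the natural number \<open>4 * m\<close>.\<close>
    have "4 * \<mu> = of_nat (4 * m) * \<omega> * \<omega> ^ n" by (simp add: \<mu>_def)
    also have "\<dots> \<le> of_nat (4 * m) * \<omega> * 1"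
      using assms(2) \<omega>1 by (intro mult_left_mono power_le_one) auto
    also have "\<dots> < 1" using inf[of "4 * m"] by simp
    finally show "4 * \<mu> < 1" .
  qed
  have scale: "(of_nat k * c * \<omega> ^ Suc n * x)\<^sup>2 \<le> (\<mu> * c * x)\<^sup>2" if "k \<le> m" "0 < x" for k x
  proof (rule power2_left_mono)
    have "of_nat k * (c * \<omega> ^ Suc n * x) \<le> of_nat m * (c * \<omega> ^ Suc n * x)"
      using that assms(1,2) by (intro mult_right_mono) auto
    then show "of_nat k * c * \<omega> ^ Suc n * x \<le> \<mu> * c * x" by (simp add: \<mu>_def mult_ac)
  qed (use assms that in auto)
  have u: "space_prod u u \<le> (\<mu> * c * a)\<^sup>2" using m1 scale[of m1 a] by (simp add: m_def)
  have p: "space_prod p p \<le> (\<mu> * c * t)\<^sup>2" using m2 scale[of m2 t] by (simp add: m_def)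
  have form: "scaled_form c \<sigma> (L q) (L r) = scaled_form c \<sigma> q r" for q r
    using L(2) by (simp add: preserves_def)
  have "c\<^sup>2 * a * a + \<sigma> * space_prod u u = c\<^sup>2"
    using form[of time_axis time_axis] by (simp add: scaled_form_def u_def a_def)
  then have a: "1 \<le> 2 * a" "a \<le> 2"
    using slow_time_component_bounds[OF assms(1) \<mu> \<sigma> m1(1) _ u] by auto
  define s where "s = p - t *s time_axis"
  have s: "p = t *s time_axis + s" "timec s = 0"
      "\<And>q. space_prod s q = space_prod p q" "\<And>q. space_prod q s = space_prod q p"
    by (simp_all add: s_def t_def)
  define w where "w = L s"
  define \<tau> where "\<tau> = timec w"
  have Lp: "L p = t *s u + w"
    unfolding u_def w_def by (subst s(1)) (simp add: linear_map_simps[OF L(1)])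
  \<comment> \<open>\<open>s\<close> is orthogonal to \<open>time_axis\<close>, hence
    \<open>w\<close> to \<open>u\<close>. Squaring this relation below removes the sign
    \<open>\<sigma>\<close>.\<close>
  have orth: "c\<^sup>2 * \<tau> * a + \<sigma> * space_prod w u = 0"
    using form[of s time_axis] s(2) by (simp add: scaled_form_def u_def a_def w_def \<tau>_def)
  have norm: "c\<^sup>2 * \<tau>\<^sup>2 + \<sigma> * space_prod w w = \<sigma> * space_prod p p"
    using form[of s s] s(2,3,4)
    by (simp add: scaled_form_def w_def \<tau>_def power2_eq_square[of "timec (L s)"] mult.assoc)
  have "(c\<^sup>2 * \<tau> * a)\<^sup>2 = (space_prod w u)\<^sup>2"
    using orth \<sigma> by (auto simp: add_eq_0_iff)
  also have "\<dots> \<le> space_prod w w * space_prod u u" by (rule space_prod_Cauchy_Schwarz)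
  also have "\<dots> \<le> space_prod w w * (\<mu> * c * a)\<^sup>2" by (intro mult_left_mono u) simp
  finally have "(c\<^sup>2 * a\<^sup>2) * (c\<^sup>2 * \<tau>\<^sup>2) \<le> (c\<^sup>2 * a\<^sup>2) * (\<mu>\<^sup>2 * space_prod w w)"
    by (simp add: power_mult_distrib power2_eq_square mult_ac)
  then have \<tau>w: "c\<^sup>2 * \<tau>\<^sup>2 \<le> \<mu>\<^sup>2 * space_prod w w"
    using c2 m1(1) by simp
  have "\<mu>\<^sup>2 \<le> (1/4)\<^sup>2" using \<mu> by (intro power2_left_mono) auto
  then have "\<mu>\<^sup>2 * space_prod w w \<le> (1/16) * space_prod w w"
    by (intro mult_right_mono) (auto simp: power2_eq_square)
  with \<tau>w have \<tau>w': "16 * (c\<^sup>2 * \<tau>\<^sup>2) \<le> space_prod w w" by simp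
  \<comment> \<open>For \<open>\<sigma> = - 1\<close> this is an equality; for
    \<open>\<sigma> = 1\<close> the term \<open>c\<^sup>2 * \<tau>\<^sup>2\<close> enters with the
    opposite sign.\<close>
  have "space_prod w w \<le> space_prod p p + c\<^sup>2 * \<tau>\<^sup>2"
    using \<sigma> norm zero_le_power2[of "c * \<tau>"] unfolding power_mult_distrib
    by (elim disjE; hypsubst; linarith)
  with \<tau>w' space_prod_self_nonneg[of p] have wp: "space_prod w w \<le> 2 * space_prod p p" by linarith
  have "16 * (c\<^sup>2 * \<tau>\<^sup>2) \<le> 2 * (\<mu> * c * t)\<^sup>2" using \<tau>w' wp p by linarith
  moreover have "(\<mu> * c * t)\<^sup>2 = c\<^sup>2 * (\<mu> * t)\<^sup>2" by (simp add: power_mult_distrib mult_ac)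
  ultimately have "c\<^sup>2 * \<tau>\<^sup>2 \<le> c\<^sup>2 * (\<mu> * t)\<^sup>2"
    using zero_le_power2[of "\<mu> * c * t"] by linarith
  then have "\<tau>\<^sup>2 \<le> (\<mu> * t)\<^sup>2" using c2 by (simp only: mult_le_cancel_left_pos)
  then have "\<bar>\<tau>\<bar> \<le> \<mu> * t" using \<mu>(1) m2(1) by (simp add: abs_le_square_iff[symmetric])
  then have "- \<tau> \<le> \<mu> * t" by (simp only: abs_le_iff)
  moreover have "4 * (\<mu> * t) < t" using \<mu>(2) m2(1) mult_strict_right_mono[of "4 * \<mu>" 1 t] by (simp add: mult_ac)
  moreover have "t \<le> 2 * (t * a)" using a(1) m2(1) mult_left_mono[of 1 "2 * a" t] by (simp add: mult_ac)
  moreover have "timec (L p) = t * a + \<tau>" unfolding Lp by (simp add: a_def \<tau>_def)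
  \<comment> \<open>\<open>t *s u\<close> contributes at least \<open>t / 2\<close> of time, and
    \<open>w\<close> takes away less than \<open>t / 4\<close>.\<close>
  ultimately have time: "t < 4 * timec (L p)" by linarith
  have "space_prod (L p) (L p) \<le> 2 * space_prod (t *s u) (t *s u) + 2 * space_prod w w"
    unfolding Lp by (rule space_prod_add_self_le)
  also have "\<dots> \<le> 2 * (t * t * (\<mu> * c * a)\<^sup>2) + 4 * (\<mu> * c * t)\<^sup>2"
  proof -
    have "space_prod (t *s u) (t *s u) = t * t * space_prod u u" by (simp add: mult.assoc)
    moreover have "t * t * space_prod u u \<le> t * t * (\<mu> * c * a)\<^sup>2" by (intro mult_left_mono u) simp
    ultimately show ?thesis using wp p by linarith
  qed
  also have "\<dots> = (2 * a\<^sup>2 + 4) * (\<mu> * c * t)\<^sup>2" by (simp add: power2_eq_square algebra_simps)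
  also have "\<dots> \<le> 16 * (\<mu> * c * t)\<^sup>2"
    using power2_left_mono[of a 2] a(2) m1(1) by (intro mult_right_mono) auto
  also have "\<dots> = (4 * (\<mu> * c * t))\<^sup>2" by (simp add: power2_eq_square)
  \<comment> \<open>The multiplier 16 is the 4 from the spatial bound times the 4 from the loss of
    time.\<close>
  also have "\<dots> \<le> (of_nat (16 * m) * c * \<omega> ^ Suc n * timec (L p))\<^sup>2"
  proof (rule power2_left_mono)
    have "4 * (\<mu> * c) * t \<le> 4 * (\<mu> * c) * (4 * timec (L p))"
      using time \<mu>(1) assms(1) by (intro mult_left_mono) auto
    then show "4 * (\<mu> * c * t) \<le> of_nat (16 * m) * c * \<omega> ^ Suc n * timec (L p)"
      by (simp add: \<mu>_def mult_ac)
  qed (use \<mu> assms m2 in auto)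
  finally show ?thesis by (rule slow_coneI) (use time m2(1) in linarith)
qed

section \<open>Inverses and boosts of form-preserving maps\<close>

lemma form_mapsD:
  assumes "L \<in> form_maps c \<sigma>"
  shows "linear_map L" "preserves (scaled_form c \<sigma>) L" "scaled_form c \<sigma> (L p) (L q) = scaled_form c \<sigma> p q"
  using assms by (simp_all add: form_maps_def preserves_def)

lemma trivial_timec:
  assumes "L \<in> trivial_linear"
  shows "timec (L p) = timec p" "space_prod (L p) (L q) = space_prod p q"
proof -
  have L: "sprod (L p) (L q) = sprod p q" "L time_axis = time_axis" for p q
    using assms by (simp_all add: trivial_linear_def preserves_def)
  show t: "timec (L p) = timec p" for p
    using L(1)[of p time_axis] by (simp add: L(2) sprod_point)
  show "space_prod (L p) (L q) = space_prod p q"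
    using L(1)[of p q] by (simp add: sprod_point t)
qed

text \<open>Trivial maps preserve the time part and the spatial product separately, hence every
  weighted combination of them.\<close>

lemma trivial_linear_subset_form_maps: "trivial_linear \<subseteq> form_maps c \<sigma>"
  unfolding form_maps_def preserves_def scaled_form_def
  by (auto simp: trivial_timec) (simp add: trivial_linear_def)

lemma scaled_form_time_axis [simp]:
  "scaled_form c \<sigma> p time_axis = c\<^sup>2 * timec p" "scaled_form c \<sigma> time_axis p = c\<^sup>2 * timec p"
  by (simp_all add: scaled_form_def)

text \<open>The inverse is the adjoint for the form: \<open>time_axis\<close> is
  \<open>L (M time_axis)\<close>, so pairing it with \<open>L p\<close> equals pairing
  \<open>M time_axis\<close> with \<open>p\<close>. Reciprocity of time dilation is the case
  \<open>p = time_axis\<close>.\<close>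

lemma timec_form_maps_inverse:
  assumes "c \<noteq> 0" "L \<in> form_maps c \<sigma>" "M \<in> form_maps c \<sigma>" "L \<circ> M = id"
  shows "c\<^sup>2 * timec (L p) = scaled_form c \<sigma> p (M time_axis)"
    "timec (M time_axis) = timec (L time_axis)"
proof -
  have LM: "L (M q) = q" for q using assms(4) by (metis comp_apply id_apply)
  show *: "c\<^sup>2 * timec (L p) = scaled_form c \<sigma> p (M time_axis)" for p
    using form_mapsD(3)[OF assms(2), of p "M time_axis"] by (simp add: LM)
  show "timec (M time_axis) = timec (L time_axis)"
    using *[of time_axis] assms(1) by simp
qed

lemma form_maps_time_axis:
  assumes "L \<in> form_maps c \<sigma>"
  shows "c\<^sup>2 * (timec (L time_axis))\<^sup>2 + \<sigma> * space_prod (L time_axis) (L time_axis) = c\<^sup>2"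
  using form_mapsD(3)[OF assms, of time_axis time_axis]
  by (simp add: power2_eq_square) (simp add: scaled_form_def power2_eq_square mult_ac)

text \<open>The form fixes the time component of \<open>L time_axis\<close> up to sign, so
  \<open>L\<close> fixes \<open>time_axis\<close>. Pairing with it shows that \<open>L\<close>
  preserves time, and what remains of the form is the spatial product.\<close>

lemma form_maps_rest:
  assumes "c \<noteq> 0" "\<sigma> \<noteq> 0" "L \<in> form_maps c \<sigma>" "spacec (L time_axis) = 0" "0 < timec (L time_axis)"
  shows "L \<in> trivial_linear"
proof -
  have "(timec (L time_axis))\<^sup>2 = 1"
    using form_maps_time_axis[OF assms(3)] assms(1,4) by simp
  then have "timec (L time_axis) = 1" using assms(5) by (simp add: power2_eq_1_iff)
  then have u: "L time_axis = time_axis" using assms(4) by (simp add: point_eq_iff)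
  have t: "timec (L p) = timec p" for p
    using form_mapsD(3)[OF assms(3), of p time_axis] assms(1) by (simp add: u)
  have "space_prod (L p) (L q) = space_prod p q" for p q
    using form_mapsD(3)[OF assms(3), of p q] assms(2) by (simp add: scaled_form_def t)
  then show ?thesis
    using u t assms(3) by (simp add: trivial_linear_def preserves_def form_maps_def sprod_point)
qed

text \<open>A rotation for \<open>\<sigma> = 1\<close> and a Lorentz boost for \<open>\<sigma> = - 1\<close>.\<close>

definition boost_map :: "'q::linordered_field \<Rightarrow> 'q \<Rightarrow> 'q \<Rightarrow> 'q \<Rightarrow> 'q point \<Rightarrow> 'q point" where
  "boost_map c \<sigma> a r p = (\<chi> i. if i = 0 then a * p $ 0 - \<sigma> * r * p $ 1
     else if i = 1 then c\<^sup>2 * r * p $ 0 + a * p $ 1 else p $ i)"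

text \<open>\<open>a\<close> and \<open>c * r\<close> act as cosine and sine, or as their hyperbolic
  counterparts; the change of the form is a multiple of the defect in \<open>unit\<close>.\<close>

lemma boost_map_in_form_maps:
  fixes c \<sigma> a r :: "'q::linordered_field"
  assumes \<sigma>: "\<sigma> = 1 \<or> \<sigma> = - 1" and unit: "a\<^sup>2 + \<sigma> * (c * r)\<^sup>2 = 1"
  shows "boost_map c \<sigma> a r \<in> form_maps c \<sigma>"
proof -
  have "linear_map (boost_map c \<sigma> a r)"
    by (rule linear_mapI) (simp_all add: boost_map_def vec_eq_iff algebra_simps)
  moreover have "scaled_form c \<sigma> (boost_map c \<sigma> a r p) (boost_map c \<sigma> a r q) = scaled_form c \<sigma> p q" for p q
  proof -
    have "scaled_form c \<sigma> (boost_map c \<sigma> a r p) (boost_map c \<sigma> a r q) - scaled_form c \<sigma> p q =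
      (a\<^sup>2 + \<sigma> * (c * r)\<^sup>2 - 1) * (c\<^sup>2 * p $ 0 * q $ 0 + \<sigma> * (p $ 1 * q $ 1))"
      using \<sigma> by (auto simp: scaled_form_def boost_map_def timec_def space_prod_coords power2_eq_square algebra_simps)
    then show ?thesis using unit by simp
  qed
  ultimately show ?thesis by (simp add: form_maps_def preserves_def)
qed

lemma boost_map_time_axis:
  "timec (boost_map c \<sigma> a r time_axis) = a"
  "space_prod (boost_map c \<sigma> a r time_axis) (boost_map c \<sigma> a r time_axis) = (c\<^sup>2 * r)\<^sup>2"
  by (simp_all add: boost_map_def timec_def space_prod_coords axis_def power2_eq_square)

text \<open>The half-angle parametrisation gives rotations and boosts with coefficients in the field.\<close>

lemma form_maps_boost:
  fixes c \<omega> \<sigma> :: "'q::linordered_field"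
  assumes c: "0 < c" and \<omega>: "0 < \<omega>" and inf: "\<And>m::nat. of_nat m * \<omega> < 1" and \<sigma>: "\<sigma> = 1 \<or> \<sigma> = - 1"
  shows "\<exists>L\<in>form_maps c \<sigma>. L time_axis \<in> slow_cone c \<omega> n \<and> L time_axis \<notin> slow_cone c \<omega> (Suc n)"
proof -
  \<comment> \<open>The tangent, or hyperbolic tangent, of the half angle. Halving
    \<open>\<omega> ^ n\<close> keeps \<open>\<tau>\<close> at most 1/2 even for
    \<open>n = 0\<close>, so that \<open>x\<close> and \<open>d\<close> stay positive.\<close>
  define \<tau> where "\<tau> = \<omega> ^ n / 2"
  define x where "x = 1 - \<sigma> * \<tau>\<^sup>2"
  define d where "d = 1 + \<sigma> * \<tau>\<^sup>2"
  have "\<omega> ^ n \<le> 1" using inf[of 1] \<omega> by (intro power_le_one) auto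
  then have \<tau>: "0 < \<tau>" "\<tau> \<le> 1/2" using \<omega> by (simp_all add: \<tau>_def)
  then have "\<tau>\<^sup>2 \<le> (1/2)\<^sup>2" by (intro power2_left_mono) auto
  then have "\<tau>\<^sup>2 \<le> 1/4" by (simp add: power2_eq_square)
  then have "- (1/4) \<le> \<sigma> * \<tau>\<^sup>2" "\<sigma> * \<tau>\<^sup>2 \<le> 1/4"
    using \<sigma> zero_le_power2[of \<tau>] by (elim disjE; hypsubst; linarith)+
  then have x: "1/2 \<le> x" "x \<le> 2" and d: "0 < d" unfolding x_def d_def by linarith+
  define r where "r = 2 * \<tau> / (d * c)"
  have "x\<^sup>2 + \<sigma> * (2 * \<tau>)\<^sup>2 = d\<^sup>2"
    using \<sigma> by (auto simp: x_def d_def power2_eq_square algebra_simps)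
  moreover have "(x / d)\<^sup>2 + \<sigma> * (c * r)\<^sup>2 = (x\<^sup>2 + \<sigma> * (2 * \<tau>)\<^sup>2) / d\<^sup>2"
    using c by (simp add: r_def power_divide add_divide_distrib)
  ultimately have "(x / d)\<^sup>2 + \<sigma> * (c * r)\<^sup>2 = 1" using d by simp
  then have L: "boost_map c \<sigma> (x / d) r \<in> form_maps c \<sigma>" using \<sigma> by (rule boost_map_in_form_maps[rotated])
  have cr: "c\<^sup>2 * r = 2 * \<tau> * c / d" using c by (simp add: r_def power2_eq_square)
  have pos: "0 < x / d" "0 < 2 * \<tau> * c / d" using x d \<tau> c by simp_all
  have \<omega>n: "\<omega> ^ n = 2 * \<tau>" by (simp add: \<tau>_def)
  \<comment> \<open>The speed is \<open>c * \<omega> ^ n / x\<close> with \<open>x\<close> between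
    1/2 and 2. The lower bound gives the multiplier 2 here; the upper bound excludes the next cone
    below.\<close>
  have "2 * \<tau> * c / d * 1 \<le> 2 * \<tau> * c / d * (2 * x)"
    using pos(2) x(1) by (intro mult_left_mono) auto
  then have "c\<^sup>2 * r \<le> of_nat 2 * c * \<omega> ^ n * (x / d)" unfolding cr \<omega>n by (simp add: mult_ac)
  then have "(c\<^sup>2 * r)\<^sup>2 \<le> (of_nat 2 * c * \<omega> ^ n * (x / d))\<^sup>2"
    using pos(2) unfolding cr by (intro power2_left_mono) auto
  then have "boost_map c \<sigma> (x / d) r time_axis \<in> slow_cone c \<omega> n"
    using pos(1) by (intro slow_coneI[where m = 2]) (simp_all only: boost_map_time_axis)
  moreover have "boost_map c \<sigma> (x / d) r time_axis \<notin> slow_cone c \<omega> (Suc n)"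
  proof
    assume "boost_map c \<sigma> (x / d) r time_axis \<in> slow_cone c \<omega> (Suc n)"
    then obtain m :: nat where "(c\<^sup>2 * r)\<^sup>2 \<le> (of_nat m * c * \<omega> ^ Suc n * (x / d))\<^sup>2"
      by (auto simp: slow_cone_def boost_map_time_axis)
    then have "c\<^sup>2 * r \<le> of_nat m * c * \<omega> ^ Suc n * (x / d)"
      by (rule power2_le_imp_le) (use c \<omega> less_imp_le[OF pos(1)] in \<open>intro mult_nonneg_nonneg; simp\<close>)
    also have "\<dots> = 2 * \<tau> * c / d * (of_nat m * \<omega> * x)" by (simp add: \<omega>n mult_ac)
    finally have "2 * \<tau> * c / d * 1 \<le> 2 * \<tau> * c / d * (of_nat m * \<omega> * x)" unfolding cr by simp
    then have "1 \<le> of_nat m * \<omega> * x" using pos(2) by (simp only: mult_le_cancel_left_pos)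
    also have "\<dots> \<le> of_nat m * \<omega> * 2" using x(2) \<omega> by (intro mult_left_mono) auto
    also have "\<dots> < 1" using inf[of "2 * m"] by (simp add: mult_ac)
    finally show False by simp
  qed
  ultimately show ?thesis using L by blast
qed

lemma kinematics_form_maps:
  fixes c \<omega> \<sigma> :: "'q::linordered_field"
  assumes "0 < c" "0 < \<omega>" "\<And>m::nat. of_nat m * \<omega> < 1" and \<sigma>: "\<sigma> = 1 \<or> \<sigma> = - 1"
  shows "kinematics c \<omega> (form_maps c \<sigma>)"
proof
  have nz: "c \<noteq> 0" "\<sigma> \<noteq> 0" using assms(1) \<sigma> by auto
  show "0 < c" "0 < \<omega>" "of_nat m * \<omega> < 1" for m by fact+
  show "transformation_group (form_maps c \<sigma>)" by (rule transformation_group_form_maps[OF nz])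
  show "\<forall>L\<in>form_maps c \<sigma>. linear_map L" by (simp add: form_maps_def)
  show "trivial_linear \<subseteq> form_maps c \<sigma>" by (rule trivial_linear_subset_form_maps)
  show "L \<in> trivial_linear"
    if "L \<in> form_maps c \<sigma>" "spacec (L time_axis) = 0" "0 < timec (L time_axis)" for L
    by (rule form_maps_rest[OF nz that])
  show "L p \<in> slow_cone c \<omega> (Suc n)"
    if "L \<in> form_maps c \<sigma>" "L time_axis \<in> slow_cone c \<omega> (Suc n)" "p \<in> slow_cone c \<omega> (Suc n)" for L n p
    by (rule slow_cone_image[OF assms form_mapsD(1,2)[OF that(1)] that(2,3)])
  show "M time_axis \<in> slow_cone c \<omega> n"
    if "L \<in> form_maps c \<sigma>" "M \<in> form_maps c \<sigma>" "L \<circ> M = id" "L time_axis \<in> slow_cone c \<omega> n" for L M n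
  proof -
    have t: "timec (M time_axis) = timec (L time_axis)"
      using timec_form_maps_inverse(2)[OF nz(1) that(1-3)] .
    \<comment> \<open>Equal time components and the invariant form leave equal spatial
      lengths.\<close>
    have "space_prod (M time_axis) (M time_axis) = space_prod (L time_axis) (L time_axis)"
      using form_maps_time_axis[OF that(1)] form_maps_time_axis[OF that(2)] nz(2) unfolding t
      by (metis add_left_cancel mult_left_cancel)
    then show ?thesis using that(4) t by (simp add: slow_cone_def)
  qed
  show "\<exists>L\<in>form_maps c \<sigma>. L time_axis \<in> slow_cone c \<omega> n \<and> L time_axis \<notin> slow_cone c \<omega> (Suc n)" for n
    by (rule form_maps_boost[OF assms])
qed

section \<open>Orthochronous Euclidean and Poincare transformations\<close>

lemma Eucl_eq: "Eucl c = affine_maps {L \<in> form_maps c 1. 0 < timec (L time_axis)}"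
  unfolding Eucl_def euclidean_isometry_def affine_maps_def form_maps_def eucl_prod_eq
  using orthochronous_affine by blast

lemma Poi_eq: "Poi c = affine_maps {L \<in> form_maps c (- 1). 0 < timec (L time_axis)}"
  unfolding Poi_def poincare_transformation_def affine_maps_def form_maps_def mink_prod_eq
  using orthochronous_affine by blast

text \<open>Up to the factor \<open>c\<^sup>2\<close>, the time component of
  \<open>L (M time_axis)\<close> is the Minkowski product of \<open>M time_axis\<close> with the
  image of \<open>time_axis\<close> under the inverse of \<open>L\<close>. Both are future timelike
  vectors, so Cauchy-Schwarz makes the product positive.\<close>

lemma transformation_group_Poi:
  fixes c :: "'q::linordered_field"
  assumes "0 < c"
  shows "transformation_group (Poi c)"
proof -
  let ?F = "form_maps c (- 1)"
  have F: "transformation_group ?F" using assms by (intro transformation_group_form_maps) auto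
  have c: "c \<noteq> 0" using assms by simp
  have "0 < timec (L (M time_axis))"
    if L: "L \<in> ?F" "0 < timec (L time_axis)" and M: "M \<in> ?F" "0 < timec (M time_axis)" for L M
  proof -
    obtain N where N: "N \<in> ?F" "L \<circ> N = id" using F L(1) by (auto simp: transformation_group_def)
    let ?u = "M time_axis" and ?v = "N time_axis"
    have v: "0 < timec ?v" using timec_form_maps_inverse(2)[OF c L(1) N] L(2) by simp
    have small: "space_prod (T time_axis) (T time_axis) < (c * timec (T time_axis))\<^sup>2" if "T \<in> ?F" for T
    proof -
      have "0 < c\<^sup>2" using assms by simp
      then show ?thesis using form_maps_time_axis[OF that] unfolding power_mult_distrib by linarith
    qed
    have "(space_prod ?u ?v)\<^sup>2 \<le> space_prod ?u ?u * space_prod ?v ?v"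
      by (rule space_prod_Cauchy_Schwarz)
    also have "\<dots> < (c * timec ?u)\<^sup>2 * (c * timec ?v)\<^sup>2"
      using small[OF M(1)] small[OF N(1)] by (intro mult_strict_mono') auto
    also have "\<dots> = (c\<^sup>2 * timec ?u * timec ?v)\<^sup>2" by (simp add: power2_eq_square mult_ac)
    finally have "space_prod ?u ?v < c\<^sup>2 * timec ?u * timec ?v"
      by (rule power_less_imp_less_base) (use M(2) v in simp)
    then have "0 < c\<^sup>2 * timec (L ?u)"
      unfolding timec_form_maps_inverse(1)[OF c L(1) N] by (simp add: scaled_form_def)
    then show ?thesis using assms by (simp add: zero_less_mult_iff)
  qed
  moreover have "0 < timec (M time_axis)"
    if "L \<in> ?F" "M \<in> ?F" "L \<circ> M = id" "0 < timec (L time_axis)" for L M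
    using timec_form_maps_inverse(2)[OF c that(1-3)] that(4) by simp
  ultimately have "transformation_group {L \<in> ?F. 0 < timec (L time_axis)}"
    using F unfolding transformation_group_def by simp blast
  then show ?thesis
    unfolding Poi_eq by (rule transformation_group_affine_maps) (simp add: form_maps_def)
qed

section \<open>Galilean kinematics\<close>

definition galilean_maps :: "('q::linordered_field point \<Rightarrow> 'q point) set" where
  "galilean_maps = {L. linear_map L \<and> (\<forall>p. \<bar>timec (L p)\<bar> = \<bar>timec p\<bar>) \<and>
     (\<forall>p q. timec p = 0 \<and> timec q = 0 \<longrightarrow> sprod (L p) (L q) = sprod p q)}"

lemma galilean_maps_linear: "L \<in> galilean_maps \<Longrightarrow> linear_map L"
  by (simp add: galilean_maps_def)

text \<open>The spatial hyperplane of time 0 is invariant, so the image splits into a drift along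
  \<open>L time_axis\<close> and a spatial part.\<close>

lemma galilean_maps_decompose:
  assumes "L \<in> galilean_maps"
  obtains s where "L p = timec p *s L time_axis + L s" "timec (L s) = 0"
    "p = timec p *s time_axis + s" "timec s = 0"
proof (rule that[of "p - timec p *s time_axis"])
  let ?s = "p - timec p *s time_axis"
  show "timec ?s = 0" by simp
  have "\<bar>timec (L ?s)\<bar> = \<bar>timec ?s\<bar>" using assms unfolding galilean_maps_def by blast
  then show "timec (L ?s) = 0" by simp
  show "p = timec p *s time_axis + ?s" by simp
  have "L ?s = L p - timec p *s L time_axis"
    using linear_map_simps[OF galilean_maps_linear[OF assms]] by metis
  then show "L p = timec p *s L time_axis + L ?s" by simp
qed

lemma galilean_maps_timec:
  assumes "L \<in> galilean_maps"
  shows "timec (L p) = timec p * timec (L time_axis)"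
proof -
  obtain s where "L p = timec p *s L time_axis + L s" "timec (L s) = 0"
    using assms by (rule galilean_maps_decompose)
  then show ?thesis by simp
qed

lemma galilean_maps_future:
  assumes "L \<in> galilean_maps" "0 < timec (L time_axis)"
  shows "timec (L time_axis) = 1" "timec (L p) = timec p"
proof -
  have "\<bar>timec (L time_axis)\<bar> = \<bar>timec time_axis\<bar>" using assms(1) unfolding galilean_maps_def by blast
  then show "timec (L time_axis) = 1" using assms(2) by simp
  then show "timec (L p) = timec p" using galilean_maps_timec[OF assms(1), of p] by simp
qed

lemma galilean_maps_space_prod:
  assumes "L \<in> galilean_maps" "timec s = 0" "timec s' = 0"
  shows "space_prod (L s) (L s') = space_prod s s'"
proof -
  have "sprod (L s) (L s') = sprod s s'" using assms unfolding galilean_maps_def by blast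
  moreover have "timec (L s) = 0" using galilean_maps_timec[OF assms(1), of s] assms(2) by simp
  ultimately show ?thesis using assms(2) by (simp add: sprod_point)
qed

lemma transformation_group_galilean_maps: "transformation_group galilean_maps"
  unfolding transformation_group_def
proof (intro conjI ballI)
  show "id \<in> galilean_maps" by (simp add: galilean_maps_def linear_mapI)
next
  fix L M :: "'a point \<Rightarrow> 'a point" assume LM: "L \<in> galilean_maps" "M \<in> galilean_maps"
  then have "timec (M p) = 0" if "timec p = 0" for p using galilean_maps_timec[OF LM(2), of p] that by simp
  then show "L \<circ> M \<in> galilean_maps" using LM by (simp add: galilean_maps_def linear_map_comp)
next
  fix L :: "'a point \<Rightarrow> 'a point" assume L: "L \<in> galilean_maps"
  have abs_timec: "\<bar>timec (L p)\<bar> = \<bar>timec p\<bar>" for p using L unfolding galilean_maps_def by blast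
  have "p = 0" if "L p = 0" for p
  proof -
    have t: "timec p = 0" using abs_timec[of p] that by simp
    then have "space_prod p p = 0" using galilean_maps_space_prod[OF L t t] that by simp
    then show ?thesis using t by (simp add: point_eq_iff)
  qed
  then obtain M where M: "linear_map M" "L \<circ> M = id" "M \<circ> L = id"
    using linear_map_inverse[OF galilean_maps_linear[OF L]] by blast
  have LM: "L (M q) = q" for q using M(2) by (metis comp_apply id_apply)
  have t: "\<bar>timec (M p)\<bar> = \<bar>timec p\<bar>" for p using abs_timec[of "M p"] by (simp add: LM)
  have "sprod (M p) (M q) = sprod p q" if "timec p = 0" "timec q = 0" for p q
  proof -
    have "timec (M p) = 0" "timec (M q) = 0" using t[of p] t[of q] that by simp_all
    then have "sprod (L (M p)) (L (M q)) = sprod (M p) (M q)"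
      using L unfolding galilean_maps_def by blast
    then show ?thesis by (simp add: LM)
  qed
  then have "M \<in> galilean_maps" using M(1) t by (simp add: galilean_maps_def)
  then show "\<exists>M\<in>galilean_maps. L \<circ> M = id \<and> M \<circ> L = id" using M by blast
qed

lemma trivial_linear_subset_galilean_maps: "trivial_linear \<subseteq> galilean_maps"
proof
  fix L :: "'a point \<Rightarrow> 'a point" assume L: "L \<in> trivial_linear"
  then show "L \<in> galilean_maps"
    using trivial_timec(1)[OF L] by (simp add: galilean_maps_def trivial_linear_def preserves_def)
qed

lemma galilean_maps_rest:
  assumes L: "L \<in> galilean_maps" and rest: "spacec (L time_axis) = 0" "0 < timec (L time_axis)"
  shows "L \<in> trivial_linear"
proof -
  note t = galilean_maps_future[OF L rest(2)]
  have u: "L time_axis = time_axis" using rest(1) t(1) by (simp add: point_eq_iff)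
  have "sprod (L p) (L q) = sprod p q" for p q
  proof -
    obtain s where s: "L p = timec p *s L time_axis + L s" "p = timec p *s time_axis + s" "timec s = 0"
      using galilean_maps_decompose[OF L] by metis
    obtain s' where s': "L q = timec q *s L time_axis + L s'" "q = timec q *s time_axis + s'" "timec s' = 0"
      using galilean_maps_decompose[OF L] by metis
    have "space_prod (L p) (L q) = space_prod (L s) (L s')" unfolding s(1) s'(1) u by simp
    also have "\<dots> = space_prod s s'" by (rule galilean_maps_space_prod[OF L s(3) s'(3)])
    also have "\<dots> = space_prod p q" by (subst s(2), subst s'(2)) simp
    finally show ?thesis by (simp add: sprod_point t(2))
  qed
  then show ?thesis using u galilean_maps_linear[OF L] by (simp add: trivial_linear_def preserves_def)
qed

text \<open>Galilean velocities add: time is preserved, and \<open>L p\<close> is the drift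
  \<open>timec p *s L time_axis\<close> plus an isometric image of the spatial part of
  \<open>p\<close>. The argument covers every exponent, including 0.\<close>

lemma galilean_slow_cone_image:
  fixes c \<omega> :: "'q::linordered_field"
  assumes "0 < c" "0 < \<omega>" and L: "L \<in> galilean_maps"
    and slow: "L time_axis \<in> slow_cone c \<omega> n" "p \<in> slow_cone c \<omega> n"
  shows "L p \<in> slow_cone c \<omega> n"
proof -
  let ?u = "L time_axis" and ?t = "timec p"
  have fut: "0 < timec ?u" "0 < ?t" using slow by (simp_all add: slow_cone_def)
  note t = galilean_maps_future[OF L fut(1)]
  obtain m1 m2 :: nat where m: "space_prod ?u ?u \<le> (of_nat m1 * c * \<omega> ^ n)\<^sup>2"
      "space_prod p p \<le> (of_nat m2 * c * \<omega> ^ n * ?t)\<^sup>2"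
    using slow by (auto simp: slow_cone_def t)
  obtain s where s: "L p = ?t *s ?u + L s" "p = ?t *s time_axis + s" "timec s = 0"
    using galilean_maps_decompose[OF L] by metis
  have "space_prod p p = space_prod s s" by (subst (1 2) s(2)) simp
  then have ps: "space_prod (L s) (L s) = space_prod p p"
    using galilean_maps_space_prod[OF L s(3) s(3)] by simp
  let ?v = "c * \<omega> ^ n * ?t"
  have "space_prod (L p) (L p) \<le> 2 * space_prod (?t *s ?u) (?t *s ?u) + 2 * space_prod (L s) (L s)"
    unfolding s(1) by (rule space_prod_add_self_le)
  also have "\<dots> \<le> 2 * (of_nat m1 * ?v)\<^sup>2 + 2 * (of_nat m2 * ?v)\<^sup>2"
    using mult_left_mono[OF m(1), of "?t * ?t"] m(2) unfolding ps
    by (simp add: power_mult_distrib) (simp add: power2_eq_square mult_ac)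
  also have "\<dots> \<le> (of_nat (2 * (m1 + m2)) * ?v)\<^sup>2"
  proof -
    \<comment> \<open>The inequality is proved for natural numbers and then transferred to the
      field.\<close>
    have "2 * m1\<^sup>2 + 2 * m2\<^sup>2 \<le> (2 * (m1 + m2))\<^sup>2"
      by (simp add: power2_eq_square algebra_simps)
    then have "of_nat (2 * m1\<^sup>2 + 2 * m2\<^sup>2) \<le> (of_nat ((2 * (m1 + m2))\<^sup>2) :: 'q)" by (simp only: of_nat_le_iff)
    then have "(2 * (of_nat m1)\<^sup>2 + 2 * (of_nat m2)\<^sup>2) * ?v\<^sup>2 \<le> (of_nat (2 * (m1 + m2)))\<^sup>2 * ?v\<^sup>2"
      by (intro mult_right_mono) (simp_all add: of_nat_power)
    then show ?thesis by (simp only: power_mult_distrib distrib_right mult.assoc)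
  qed
  finally have "space_prod (L p) (L p) \<le> (of_nat (2 * (m1 + m2)) * c * \<omega> ^ n * timec (L p))\<^sup>2"
    by (simp only: t(2) mult.assoc)
  then show ?thesis by (rule slow_coneI) (simp only: t(2) fut(2))
qed

text \<open>\<open>M time_axis - time_axis\<close> is spatial, and \<open>L\<close> sends it to
  \<open>time_axis - L time_axis\<close>; isometry on spatial vectors gives opposite motions the
  same speed.\<close>

lemma galilean_slow_cone_inverse:
  assumes L: "L \<in> galilean_maps" and M: "M \<in> galilean_maps" "L \<circ> M = id"
    and slow: "L time_axis \<in> slow_cone c \<omega> n"
  shows "M time_axis \<in> slow_cone c \<omega> n"
proof -
  have LM: "L (M q) = q" for q using M(2) by (metis comp_apply id_apply)
  have "0 < timec (L time_axis)" using slow by (simp add: slow_cone_def)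
  note t = galilean_maps_future[OF L this]
  have tM: "timec (M time_axis) = 1" using t(2)[of "M time_axis"] by (simp add: LM)
  let ?s = "M time_axis - time_axis"
  have "L ?s = time_axis - L time_axis"
    using linear_map_simps(4)[OF galilean_maps_linear[OF L]] by (simp add: LM)
  then have "space_prod (L time_axis) (L time_axis) = space_prod (L ?s) (L ?s)" by simp
  also have "\<dots> = space_prod ?s ?s" using tM by (intro galilean_maps_space_prod[OF L]) simp_all
  also have "\<dots> = space_prod (M time_axis) (M time_axis)" by simp
  finally show ?thesis using slow tM t(1) by (simp add: slow_cone_def)
qed

lemma galilean_boost:
  fixes c \<omega> :: "'q::linordered_field"
  assumes c: "0 < c" and \<omega>: "0 < \<omega>" and inf: "\<And>m::nat. of_nat m * \<omega> < 1"
  shows "\<exists>L\<in>galilean_maps. L time_axis \<in> slow_cone c \<omega> n \<and> L time_axis \<notin> slow_cone c \<omega> (Suc n)"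
proof -
  define v where "v = c * \<omega> ^ n"
  have v: "0 < v" using c \<omega> by (simp add: v_def)
  \<comment> \<open>A shear along the first spatial axis with velocity exactly
    \<open>c * \<omega> ^ n\<close>.\<close>
  define L :: "'q point \<Rightarrow> 'q point" where "L p = p + (timec p * v) *s axis 1 1" for p
  have time: "timec (L p) = timec p" for p by (simp add: L_def) (simp add: timec_def axis_def)
  have "linear_map L" by (rule linear_mapI) (simp_all add: L_def vec_eq_iff algebra_simps)
  then have L: "L \<in> galilean_maps" by (simp add: galilean_maps_def time) (simp add: L_def)
  have space: "space_prod (L time_axis) (L time_axis) = v\<^sup>2"
    by (simp add: L_def space_prod_coords) (simp add: axis_def power2_eq_square)
  have "space_prod (L time_axis) (L time_axis) \<le> (of_nat 1 * c * \<omega> ^ n * timec (L time_axis))\<^sup>2"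
    by (simp add: space time v_def)
  then have "L time_axis \<in> slow_cone c \<omega> n" by (rule slow_coneI) (simp add: time)
  moreover have "L time_axis \<notin> slow_cone c \<omega> (Suc n)"
  proof
    assume "L time_axis \<in> slow_cone c \<omega> (Suc n)"
    then obtain m :: nat where "v\<^sup>2 \<le> (of_nat m * c * \<omega> ^ Suc n)\<^sup>2"
      by (auto simp: slow_cone_def space time)
    then have "v \<le> of_nat m * c * \<omega> ^ Suc n"
      by (rule power2_le_imp_le) (use c \<omega> in simp)
    also have "\<dots> = v * (of_nat m * \<omega>)" by (simp add: v_def mult_ac)
    also have "\<dots> < v * 1" using inf[of m] v by (intro mult_strict_left_mono)
    finally show False by simp
  qed
  ultimately show ?thesis using L by blast
qed

lemma kinematics_galilean_maps:
  fixes c \<omega> :: "'q::linordered_field"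
  assumes "0 < c" "0 < \<omega>" "\<And>m::nat. of_nat m * \<omega> < 1"
  shows "kinematics c \<omega> galilean_maps"
proof
  show "0 < c" "0 < \<omega>" "of_nat m * \<omega> < 1" for m by fact+
  show "transformation_group galilean_maps" by (rule transformation_group_galilean_maps)
  show "\<forall>L\<in>galilean_maps. linear_map L" by (simp add: galilean_maps_linear)
  show "trivial_linear \<subseteq> galilean_maps" by (rule trivial_linear_subset_galilean_maps)
  show "L \<in> trivial_linear"
    if "L \<in> galilean_maps" "spacec (L time_axis) = 0" "0 < timec (L time_axis)" for L
    by (rule galilean_maps_rest[OF that])
  show "L p \<in> slow_cone c \<omega> (Suc n)"
    if "L \<in> galilean_maps" "L time_axis \<in> slow_cone c \<omega> (Suc n)" "p \<in> slow_cone c \<omega> (Suc n)" for L n p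
    by (rule galilean_slow_cone_image[OF assms(1,2) that])
  show "M time_axis \<in> slow_cone c \<omega> n"
    if "L \<in> galilean_maps" "M \<in> galilean_maps" "L \<circ> M = id" "L time_axis \<in> slow_cone c \<omega> n" for L M n
    by (rule galilean_slow_cone_inverse[OF that])
  show "\<exists>L\<in>galilean_maps. L time_axis \<in> slow_cone c \<omega> n \<and> L time_axis \<notin> slow_cone c \<omega> (Suc n)" for n
    by (rule galilean_boost[OF assms])
qed

section \<open>The orthochronous Galilean group\<close>

lemma Gal_eq: "Gal = affine_maps {L \<in> galilean_maps. 0 < timec (L time_axis)}"
proof (intro Set.set_eqI iffI)
  fix f :: "'a point \<Rightarrow> 'a point"
  assume "f \<in> Gal"
  then have f: "galilean_transformation f" "orthochronous f" by (simp_all add: Gal_def)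
  obtain a L where L: "L \<in> galilean_maps" "f = translation_by a \<circ> L"
    using f(1) unfolding galilean_transformation_def galilean_maps_def by blast
  then have "0 < timec (L time_axis)" using f(2) orthochronous_affine[OF galilean_maps_linear] by blast
  then show "f \<in> affine_maps {L \<in> galilean_maps. 0 < timec (L time_axis)}"
    using L unfolding affine_maps_def by blast
next
  fix f :: "'a point \<Rightarrow> 'a point"
  assume "f \<in> affine_maps {L \<in> galilean_maps. 0 < timec (L time_axis)}"
  then obtain a L where L: "L \<in> galilean_maps" "0 < timec (L time_axis)" "f = translation_by a \<circ> L"
    by (elim affine_maps_cases) blast
  then have "orthochronous f" using orthochronous_affine[OF galilean_maps_linear] by blast
  moreover have "galilean_transformation f"
    using L(1,3) unfolding galilean_transformation_def galilean_maps_def by blast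
  ultimately show "f \<in> Gal" by (simp add: Gal_def)
qed

text \<open>Orthochronous Galilean maps with no translation part preserve the time component itself,
  so orthochrony survives composition and inversion.\<close>

lemma transformation_group_Gal: "transformation_group (Gal :: ('q::linordered_field point \<Rightarrow> 'q point) set)"
proof -
  have G: "transformation_group (galilean_maps :: ('q point \<Rightarrow> 'q point) set)"
    by (rule transformation_group_galilean_maps)
  have "transformation_group {L \<in> galilean_maps. 0 < timec (L (time_axis :: 'q point))}"
    unfolding transformation_group_def
  proof (intro conjI ballI)
    show "id \<in> {L \<in> galilean_maps. 0 < timec (L (time_axis :: 'q point))}"
      using G unfolding transformation_group_def by simp
  next
    fix L M :: "'q point \<Rightarrow> 'q point"
    assume L: "L \<in> {L \<in> galilean_maps. 0 < timec (L time_axis)}"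
      and M: "M \<in> {L \<in> galilean_maps. 0 < timec (L time_axis)}"
    have "timec (L (M time_axis)) = timec (M time_axis)" using galilean_maps_future(2)[of L] L by blast
    then show "L \<circ> M \<in> {L \<in> galilean_maps. 0 < timec (L time_axis)}"
      using L M transformation_group_comp[OF G] by simp
  next
    fix L :: "'q point \<Rightarrow> 'q point"
    assume L: "L \<in> {L \<in> galilean_maps. 0 < timec (L time_axis)}"
    then obtain M where M: "M \<in> galilean_maps" "L \<circ> M = id" "M \<circ> L = id"
      using G unfolding transformation_group_def by blast
    have "timec (L (M time_axis)) = timec (M time_axis)" using galilean_maps_future(2)[of L] L by blast
    moreover have "L (M time_axis) = time_axis" using M(2) by (metis comp_apply id_apply)
    ultimately have "0 < timec (M time_axis)" by simp
    then show "\<exists>M\<in>{L \<in> galilean_maps. 0 < timec (L time_axis)}. L \<circ> M = id \<and> M \<circ> L = id"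
      using M by blast
  qed
  then show ?thesis
    unfolding Gal_eq by (rule transformation_group_affine_maps) (simp add: galilean_maps_linear)
qed

section \<open>Infinitesimals and the three chains\<close>

lemma infinitesimal_exists:
  fixes x :: "'q::linordered_field"
  assumes "\<forall>n::nat. of_nat n < x"
  obtains \<omega> :: 'q where "0 < \<omega>" "\<And>m::nat. of_nat m * \<omega> < 1"
proof
  have "0 < x" using assms[rule_format, of 0] by simp
  then show "0 < inverse x" "of_nat m * inverse x < 1" for m :: nat
    using assms by (simp_all add: field_simps)
qed

theorem theorem5:
  fixes c :: "'q::linordered_field"
  assumes non_archimedean: "\<exists>x::'q. \<forall>n::nat. of_nat n < x"
    and "c > 0"
  shows "(\<exists>(ME :: 'q std_model) (MG :: 'q std_model) (MP :: 'q std_model).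
            borisov_model ME \<and> borisov_model MG \<and> borisov_model MP \<and>
            proper_subgroup Triv (wvts ME) \<and> wvts ME \<subset> Eucl c \<and>
            proper_subgroup Triv (wvts MG) \<and> proper_subgroup (wvts MG) Gal \<and>
            proper_subgroup Triv (wvts MP) \<and> proper_subgroup (wvts MP) (Poi c))
       \<and> (\<exists>ME :: nat \<Rightarrow> 'q std_model. borisov_chain ME \<and> wvts (ME 0) \<subset> Eucl c)
       \<and> (\<exists>MG :: nat \<Rightarrow> 'q std_model. borisov_chain MG \<and> proper_subgroup (wvts (MG 0)) Gal)
       \<and> (\<exists>MP :: nat \<Rightarrow> 'q std_model. borisov_chain MP \<and> proper_subgroup (wvts (MP 0)) (Poi c))"
proof -
  obtain \<omega> :: 'q where \<omega>: "0 < \<omega>" "\<And>m::nat. of_nat m * \<omega> < 1"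
    using non_archimedean infinitesimal_exists by blast
  interpret E: kinematics c \<omega> "form_maps c 1" by (rule kinematics_form_maps[OF \<open>c > 0\<close> \<omega>]) simp
  interpret P: kinematics c \<omega> "form_maps c (- 1)" by (rule kinematics_form_maps[OF \<open>c > 0\<close> \<omega>]) simp
  interpret G: kinematics c \<omega> galilean_maps by (rule kinematics_galilean_maps[OF \<open>c > 0\<close> \<omega>])
  obtain ME :: "nat \<Rightarrow> 'q std_model" where ME: "borisov_chain ME" "wvts (ME 0) \<subset> Eucl c"
    unfolding Eucl_eq by (rule E.descending_chain)
  obtain MP :: "nat \<Rightarrow> 'q std_model" where MP: "borisov_chain MP" "wvts (MP 0) \<subset> Poi c"
      "transformation_group (wvts (MP 0))"
    unfolding Poi_eq by (rule P.descending_chain)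
  obtain MG :: "nat \<Rightarrow> 'q std_model" where MG: "borisov_chain MG" "wvts (MG 0) \<subset> Gal"
      "transformation_group (wvts (MG 0))"
    unfolding Gal_eq by (rule G.descending_chain)
  \<comment> \<open>The Euclidean case is left as a proper inclusion, since \<open>Eucl c\<close> is
    not a group.\<close>
  have "proper_subgroup (wvts (MP 0)) (Poi c)" "proper_subgroup (wvts (MG 0)) Gal"
    using proper_subgroupI MP(2,3) MG(2,3) transformation_group_Poi[OF \<open>c > 0\<close>] transformation_group_Gal
    by blast+
  \<comment> \<open>The top members of the three chains serve as the single models.\<close>
  moreover have "borisov_model (ME 0) \<and> borisov_model (MG 0) \<and> borisov_model (MP 0) \<and>
      proper_subgroup Triv (wvts (ME 0)) \<and> proper_subgroup Triv (wvts (MG 0)) \<and>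
      proper_subgroup Triv (wvts (MP 0))"
    using ME(1) MG(1) MP(1) by (simp add: borisov_chain_def)
  ultimately show ?thesis using ME MG(1) MP(1) by blast
qed

end
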